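(* Let $(G,\mu,\alpha,\beta)$ and $(G',\mu',\alpha',\beta')$ be BiHom-algebras over a field $\mathbb K$ of characteristic $0$, and let $(G^{\circ},\Delta,\beta^{\circ},\alpha^{\circ})$ and $(G'^{\circ},\Delta',\beta'^{\circ},\alpha'^{\circ})$ be their Sweedler dual BiHom-coalgebras. Let $f:G\to G'$ be a morphism of BiHom-algebras, and let $f^{\circ}=f^{*}|_{G'^{\circ}}:G'^{\circ}\to G^{*}$, where $f^{*}(h)=h\circ f$. Then $f^{\circ}$ is a morphism of BiHom-coalgebras from $(G'^{\circ},\Delta',\beta'^{\circ},\alpha'^{\circ})$ to $(G^{\circ},\Delta,\beta^{\circ},\alpha^{\circ})$ (in particular it takes values in $G^{\circ}$).
   Context: All vector spaces and tensor products are over a field $\mathbb K$ of characteristic $0$; spaces may be infinite-dimensional. $V^{*}$ denotes the full linear dual. A BiHom-algebra is a quadruple $(G,\mu,\alpha,\beta)$ with $G$ a vector space, $\mu:G\otimes G\to G$ linear, written $\mu(g\otimes h)=gh$, and $\alpha,\beta:G\to G$ linear with $\alpha\circ\beta=\beta\circ\alpha$, such that for all $g,h,k\in G$: $\alpha(g)(hk)=(gh)\beta(k)$, $\alpha(hk)=\alpha(h)\alpha(k)$, $\beta(hk)=\beta(h)\beta(k)$. No unit is assumed. A morphism of BiHom-algebras $(G,\mu,\alpha,\beta)\to(G',\mu',\alpha',\beta')$ is a linear map $f:G\to G'$ with $\mu'\circ(f\otimes f)=f\circ\mu$, $f\circ\alpha=\alpha'\circ f$, $f\circ\beta=\beta'\circ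 f$. An ideal of $G$ is a subspace $H\subseteq G$ with $\alpha(H)\subseteq H$, $\beta(H)\subseteq H$, and $ab\in H$, $ba\in H$ for all $a\in G$, $b\in H$. It is finite-codimensional if $\dim(G/H)<\infty$. The Sweedler dual of $G$ is $G^{\circ}=\{f\in G^{*}\mid \text{there is a finite-codimensional ideal } J\subseteq G \text{ with } f(J)=0\}$. A BiHom-coalgebra is a quadruple $(C,\Delta,\psi,\phi)$ with $C$ a vector space, $\Delta:C\to C\otimes C$ linear, $\psi,\phi:C\to C$ commuting linear maps, such that $(\phi\otimes\Delta)\circ\Delta=(\Delta\otimes\psi)\circ\Delta$, $\Delta\circ\psi=(\psi\otimes\psi)\circ\Delta$, $\Delta\circ\phi=(\phi\otimes\phi)\circ\Delta$. A morphism of BiHom-coalgebras is a linear map commuting with the comultiplications ($\Delta_{D}\circ h=(h\otimes h)\circ\Delta_{C}$ for $h:C\to D$) and with the respective twisting maps $\psi$ and $\phi$. The Sweedler dual BiHom-coalgebra of $(G,\mu,\alpha,\beta)$ is $(G^{\circ},\Delta,\beta^{\circ},\alpha^{\circ})$ (so $\psi=\beta^{\circ}$, $\phi=\alpha^{\circ}$) with $\Delta(f)=f\circ\mu$, $\alpha^{\circ}(f)=f\circ\alpha$, $\beta^{\circ}(f)=f\circ\beta$ for $f\in G^{\circ}$; here $f\circ\mu\in(G\otimes G)^{*}$ lies in $G^{\circ}\otimes G^{\circ}$, viewed as a subspace of $(G\otimes G)^{*}$ via $(f\otimes g)(x\otimes y)=f(x)g(y)$. It is a known fact that this is a BiHom-coalgebra.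 The same notation with primes is used for $G'$. *)

theory Defs
  imports Complex_Main "HOL-Library.Function_Algebras"
begin

section \<open>Vector spaces with a carrier\<close>

text \<open>
  A vector space is a subspace of a type: the Sweedler dual below is a proper subspace of a
  function space.
\<close>

record ('k, 'v) vspace =
  scl :: "'k \<Rightarrow> 'v \<Rightarrow> 'v"
  vecs :: "'v set"

definition is_vspace :: "('k::field, 'v::ab_group_add, 'm) vspace_scheme \<Rightarrow> bool" where
  "is_vspace X \<longleftrightarrow> vector_space (scl X) \<and> module.subspace (scl X) (vecs X)"

definition whole_space :: "('k \<Rightarrow> 'v \<Rightarrow> 'v) \<Rightarrow> ('k, 'v) vspace" where
  "whole_space s = \<lparr>scl = s, vecs = UNIV\<rparr>"

abbreviation base_field :: "('k::field, 'k) vspace" where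
  "base_field \<equiv> whole_space (*)"

definition fun_scale :: "'k::field \<Rightarrow> ('a \<Rightarrow> 'k) \<Rightarrow> 'a \<Rightarrow> 'k" where
  "fun_scale c f = (\<lambda>x. c * f x)"

definition linear_map ::
  "('k::field, 'v::ab_group_add, 'm) vspace_scheme \<Rightarrow> ('k, 'w::ab_group_add, 'n) vspace_scheme
    \<Rightarrow> ('v \<Rightarrow> 'w) \<Rightarrow> bool" where
  "linear_map X Y f \<longleftrightarrow>
     (\<forall>x\<in>vecs X. f x \<in> vecs Y) \<and>
     (\<forall>x\<in>vecs X. \<forall>y\<in>vecs X. f (x + y) = f x + f y) \<and>
     (\<forall>c. \<forall>x\<in>vecs X. f (scl X c x) = scl Y c (f x))"

definition bilinear_map ::
  "('k::field, 'v::ab_group_add, 'm) vspace_scheme \<Rightarrow> ('k, 'w::ab_group_add, 'n) vspace_scheme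
    \<Rightarrow> ('k, 'u::ab_group_add, 'o) vspace_scheme \<Rightarrow> ('v \<Rightarrow> 'w \<Rightarrow> 'u) \<Rightarrow> bool" where
  "bilinear_map X Y Z b \<longleftrightarrow>
     (\<forall>x\<in>vecs X. linear_map Y Z (b x)) \<and> (\<forall>y\<in>vecs Y. linear_map X Z (\<lambda>x. b x y))"


section \<open>Tensor products\<close>

text \<open>
  The tensor \<open>x \<otimes> y\<close> is realised as evaluation at \<open>(x, y)\<close> on the bilinear forms on \<open>X \<times> Y\<close>
  (and as \<open>0\<close> on functions that are not bilinear forms), and \<open>X \<otimes> Y\<close> is the linear span of
  these elements.  Over a field this is a tensor product; its universal property is
  \<open>tensor_universal\<close> below.
\<close>

type_synonym ('k, 'v, 'w) tensor = "('v \<Rightarrow> 'w \<Rightarrow> 'k) \<Rightarrow> 'k"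

definition pure_tensor ::
  "('k::field, 'v::ab_group_add, 'm) vspace_scheme \<Rightarrow> ('k, 'w::ab_group_add, 'n) vspace_scheme
    \<Rightarrow> 'v \<Rightarrow> 'w \<Rightarrow> ('k, 'v, 'w) tensor" where
  "pure_tensor X Y x y = (\<lambda>B. if bilinear_map X Y base_field B then B x y else 0)"

definition tensor_space ::
  "('k::field, 'v::ab_group_add, 'm) vspace_scheme \<Rightarrow> ('k, 'w::ab_group_add, 'n) vspace_scheme
    \<Rightarrow> ('k, ('k, 'v, 'w) tensor) vspace" where
  "tensor_space X Y =
     \<lparr>scl = fun_scale,
      vecs = module.span fun_scale {pure_tensor X Y x y | x y. x \<in> vecs X \<and> y \<in> vecs Y}\<rparr>"

text \<open>\<open>tensor_map X' Y' h k\<close> is \<open>h \<otimes> k : X \<otimes> Y \<rightarrow> X' \<otimes> Y'\<close>, and \<open>tensor_assoc X Y Z\<close> is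
  the canonical map \<open>(X \<otimes> Y) \<otimes> Z \<rightarrow> X \<otimes> (Y \<otimes> Z)\<close>; see \<open>tensor_map_pure\<close>, \<open>tensor_assoc_pure\<close>.\<close>

definition tensor_map ::
  "('k::field, 'v'::ab_group_add, 'm) vspace_scheme \<Rightarrow> ('k, 'w'::ab_group_add, 'n) vspace_scheme
    \<Rightarrow> ('v \<Rightarrow> 'v') \<Rightarrow> ('w \<Rightarrow> 'w') \<Rightarrow> ('k, 'v, 'w) tensor \<Rightarrow> ('k, 'v', 'w') tensor" where
  "tensor_map X' Y' h k t =
     (\<lambda>B. if bilinear_map X' Y' base_field B then t (\<lambda>x y. B (h x) (k y)) else 0)"

definition tensor_assoc ::
  "('k::field, 'v::ab_group_add, 'm) vspace_scheme \<Rightarrow> ('k, 'w::ab_group_add, 'n) vspace_scheme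
    \<Rightarrow> ('k, 'u::ab_group_add, 'o) vspace_scheme
    \<Rightarrow> ('k, ('k, 'v, 'w) tensor, 'u) tensor \<Rightarrow> ('k, 'v, ('k, 'w, 'u) tensor) tensor" where
  "tensor_assoc X Y Z t =
     (\<lambda>B. if bilinear_map X (tensor_space Y Z) base_field B
          then t (\<lambda>s z. s (\<lambda>x y. B x (pure_tensor Y Z y z))) else 0)"

text \<open>The map \<open>P \<otimes> Q \<rightarrow> (X \<otimes> Y)\<^sup>*\<close>, for \<open>P \<subseteq> X\<^sup>*\<close> and \<open>Q \<subseteq> Y\<^sup>*\<close>, which sends
  \<open>f \<otimes> g\<close> to the form \<open>x \<otimes> y \<mapsto> f x * g y\<close>; see \<open>tensor_form_pure\<close>.\<close>

definition tensor_form ::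
  "('k::field, 'v \<Rightarrow> 'k, 'w \<Rightarrow> 'k) tensor \<Rightarrow> ('k, 'v, 'w) tensor \<Rightarrow> 'k" where
  "tensor_form t s = t (\<lambda>f g. s (\<lambda>x y. f x * g y))"


subsection \<open>The universal property\<close>

interpretation fun_space: vector_space "fun_scale :: 'k::field \<Rightarrow> ('a \<Rightarrow> 'k) \<Rightarrow> 'a \<Rightarrow> 'k"
  by unfold_locales (auto simp: fun_scale_def fun_eq_iff algebra_simps)

lemma base_field_simps [simp]: "scl base_field = (*)" "vecs base_field = UNIV"
  by (auto simp: whole_space_def)

lemma scl_tensor_space [simp]: "scl (tensor_space X Y) = fun_scale"
  by (simp add: tensor_space_def)

lemma is_vspace_tensor_space: "is_vspace (tensor_space X Y)"
  unfolding is_vspace_def tensor_space_def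
  by (simp add: fun_space.vector_space_axioms)

lemma pure_tensor_in:
  assumes "x \<in> vecs X" "y \<in> vecs Y"
  shows "pure_tensor X Y x y \<in> vecs (tensor_space X Y)"
  unfolding tensor_space_def using assms by (auto intro!: fun_space.span_base)

lemma tensor_space_induct [consumes 1, case_names pure zero add scale]:
  assumes "t \<in> vecs (tensor_space X Y)"
    and pure: "\<And>x y. x \<in> vecs X \<Longrightarrow> y \<in> vecs Y \<Longrightarrow> P (pure_tensor X Y x y)"
    and zero: "P 0"
    and add: "\<And>s t. s \<in> vecs (tensor_space X Y) \<Longrightarrow> t \<in> vecs (tensor_space X Y) \<Longrightarrow>
               P s \<Longrightarrow> P t \<Longrightarrow> P (s + t)"
    and scale: "\<And>c t. t \<in> vecs (tensor_space X Y) \<Longrightarrow> P t \<Longrightarrow> P (fun_scale c t)"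
  shows "P t"
proof -
  let ?S = "{pure_tensor X Y x y | x y. x \<in> vecs X \<and> y \<in> vecs Y}"
  have V: "vecs (tensor_space X Y) = fun_space.span ?S"
    by (simp add: tensor_space_def)
  have "fun_space.subspace {t \<in> fun_space.span ?S. P t}"
    using zero add scale
    by (intro fun_space.subspaceI)
      (auto simp: V fun_space.span_zero intro: fun_space.span_add fun_space.span_scale)
  moreover have "?S \<subseteq> {t \<in> fun_space.span ?S. P t}"
    using pure by (auto intro: fun_space.span_base)
  ultimately have "fun_space.span ?S \<subseteq> {t \<in> fun_space.span ?S. P t}"
    by (rule fun_space.span_minimal[rotated])
  thus ?thesis using assms(1) by (auto simp: V)
qed

lemma bilinear_pure_tensor:
  assumes "is_vspace X" "is_vspace Y"
  shows "bilinear_map X Y (tensor_space X Y) (pure_tensor X Y)"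
  using assms
  by (auto simp: bilinear_map_def linear_map_def pure_tensor_in)
    (auto simp: bilinear_map_def linear_map_def pure_tensor_def fun_scale_def fun_eq_iff)

theorem tensor_universal:
  fixes X :: "('k::field, 'v::ab_group_add, 'm) vspace_scheme"
    and Y :: "('k, 'w::ab_group_add, 'n) vspace_scheme"
    and Z :: "('k, 'u::ab_group_add, 'o) vspace_scheme"
  assumes Z: "is_vspace Z" and b: "bilinear_map X Y Z b"
  shows "\<exists>l. linear_map (tensor_space X Y) Z l \<and>
             (\<forall>x\<in>vecs X. \<forall>y\<in>vecs Y. l (pure_tensor X Y x y) = b x y)"
proof -
  let ?S = "{pure_tensor X Y x y | x y. x \<in> vecs X \<and> y \<in> vecs Y}"
  have vZ: "vector_space (scl Z)" and sZ: "module.subspace (scl Z) (vecs Z)"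
    using Z by (auto simp: is_vspace_def)
  interpret Zs: vector_space "scl Z" by fact
  interpret p: vector_space_pair "fun_scale :: 'k \<Rightarrow> ('k, 'v, 'w) tensor \<Rightarrow> _" "scl Z"
    by unfold_locales
  interpret K: vector_space "(*) :: 'k \<Rightarrow> 'k \<Rightarrow> 'k"
    by unfold_locales (auto simp: algebra_simps)
  interpret q: vector_space_pair "scl Z" "(*) :: 'k \<Rightarrow> 'k \<Rightarrow> 'k"
    by unfold_locales
  obtain E where E: "E \<subseteq> ?S" "fun_space.independent E" "?S \<subseteq> fun_space.span E"
    using fun_space.maximal_independent_subset by blast
  have "\<forall>e\<in>E. \<exists>z. \<exists>x\<in>vecs X. \<exists>y\<in>vecs Y. e = pure_tensor X Y x y \<and> z = b x y"
    using E(1) by blast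
  then obtain z where z: "\<And>e. e \<in> E \<Longrightarrow> \<exists>x\<in>vecs X. \<exists>y\<in>vecs Y. e = pure_tensor X Y x y \<and> z e = b x y"
    by metis
  obtain l where l: "Vector_Spaces.linear fun_scale (scl Z) l" "\<And>e. e \<in> E \<Longrightarrow> l e = z e"
    using p.linear_independent_extend[OF E(2)] by metis
  interpret l: Vector_Spaces.linear fun_scale "scl Z" l by fact
  have key: "t (\<lambda>x y. f (b x y)) = f (l t)"
    if f: "Vector_Spaces.linear (scl Z) (*) f" and t: "t \<in> fun_space.span E" for f t
  proof -
    interpret f: Vector_Spaces.linear "scl Z" "(*)" f by fact
    have bil: "bilinear_map X Y base_field (\<lambda>x y. f (b x y))"
      using b by (simp add: bilinear_map_def linear_map_def f.add f.scale)
    show ?thesis using t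
    proof (induction rule: fun_space.span_induct_alt)
      case base
      show ?case unfolding l.zero f.zero by simp
    next
      case (step c e t)
      obtain x y where "x \<in> vecs X" "y \<in> vecs Y" "e = pure_tensor X Y x y" "z e = b x y"
        using z[OF step(1)] by blast
      hence "e (\<lambda>x y. f (b x y)) = f (l e)"
        using bil l(2)[OF step(1)] by (simp add: pure_tensor_def)
      moreover have "f (l (fun_scale c e + t)) = c * f (l e) + f (l t)"
        by (simp only: l.add l.scale f.add f.scale)
      moreover have "(fun_scale c e + t) (\<lambda>x y. f (b x y)) =
          c * e (\<lambda>x y. f (b x y)) + t (\<lambda>x y. f (b x y))"
        by (simp add: fun_scale_def)
      ultimately show ?case using step(2) by metis
    qed
  qed
  have lp: "l (pure_tensor X Y x y) = b x y" if x: "x \<in> vecs X" and y: "y \<in> vecs Y" for x y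
  proof (rule ccontr)
    assume neq: "l (pure_tensor X Y x y) \<noteq> b x y"
    define d where "d = l (pure_tensor X Y x y) - b x y"
    have "Zs.independent {d}" using neq by (simp add: d_def)
    then obtain f where f: "Vector_Spaces.linear (scl Z) (*) f" "f d = (1::'k)"
      using q.linear_independent_extend[of "{d}" "\<lambda>_. 1"] by auto
    interpret f: Vector_Spaces.linear "scl Z" "(*)" f by fact
    have bil: "bilinear_map X Y base_field (\<lambda>x y. f (b x y))"
      using b by (simp add: bilinear_map_def linear_map_def f.add f.scale)
    have "pure_tensor X Y x y \<in> fun_space.span E" using E(3) x y by blast
    from key[OF f(1) this] bil have "f (b x y) = f (l (pure_tensor X Y x y))"
      by (simp add: pure_tensor_def)
    hence "f d = 0" by (simp add: d_def f.diff)
    thus False using f(2) by simp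
  qed
  have "l t \<in> vecs Z" if "t \<in> vecs (tensor_space X Y)" for t
    using that
  proof (induction rule: tensor_space_induct)
    case (pure x y)
    thus ?case using b by (simp add: lp bilinear_map_def linear_map_def)
  next
    case zero
    show ?case unfolding l.zero using sZ by (rule Zs.subspace_0)
  next
    case (add s t)
    thus ?case unfolding l.add using sZ Zs.subspace_add by blast
  next
    case (scale c t)
    thus ?case unfolding l.scale using sZ Zs.subspace_scale by blast
  qed
  hence "linear_map (tensor_space X Y) Z l"
    unfolding linear_map_def scl_tensor_space using l.add l.scale by blast
  thus ?thesis using lp by blast
qed

lemma linear_map_zero:
  assumes "is_vspace X" "is_vspace Y" "linear_map X Y l"
  shows "l 0 = 0"
proof -
  interpret X: vector_space "scl X" using assms by (simp add: is_vspace_def)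
  interpret Y: vector_space "scl Y" using assms by (simp add: is_vspace_def)
  have "0 \<in> vecs X" using assms X.subspace_0 by (auto simp: is_vspace_def)
  hence "l (scl X 0 0) = scl Y 0 (l 0)" using assms(3) unfolding linear_map_def by blast
  thus ?thesis by (simp only: X.scale_zero_left Y.scale_zero_left)
qed

theorem tensor_unique:
  assumes "is_vspace Z" "linear_map (tensor_space X Y) Z l" "linear_map (tensor_space X Y) Z l'"
    and "\<And>x y. x \<in> vecs X \<Longrightarrow> y \<in> vecs Y \<Longrightarrow> l (pure_tensor X Y x y) = l' (pure_tensor X Y x y)"
    and "t \<in> vecs (tensor_space X Y)"
  shows "l t = l' t"
  using assms(5)
proof (induction rule: tensor_space_induct)
  case zero
  show ?case using assms linear_map_zero is_vspace_tensor_space by metis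
next
  case (add s t)
  thus ?case using assms(2,3) unfolding linear_map_def by metis
next
  case (scale c t)
  thus ?case using assms(2,3) unfolding linear_map_def scl_tensor_space by metis
qed (use assms in simp)

lemma bilinear_map_compose:
  assumes "bilinear_map X' Y' Z B" "linear_map X X' h" "linear_map Y Y' k"
  shows "bilinear_map X Y Z (\<lambda>x y. B (h x) (k y))"
  using assms by (auto simp: bilinear_map_def linear_map_def)

lemma tensor_map_pure:
  assumes "linear_map X X' h" "linear_map Y Y' k"
  shows "tensor_map X' Y' h k (pure_tensor X Y x y) = pure_tensor X' Y' (h x) (k y)"
  using bilinear_map_compose[OF _ assms, of base_field]
  by (auto simp: tensor_map_def pure_tensor_def fun_eq_iff)

lemma tensor_map_linear:
  assumes "linear_map X X' h" "linear_map Y Y' k"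
  shows "linear_map (tensor_space X Y) (tensor_space X' Y') (tensor_map X' Y' h k)"
proof -
  have hom: "tensor_map X' Y' h k (s + t) = tensor_map X' Y' h k s + tensor_map X' Y' h k t"
    "tensor_map X' Y' h k (fun_scale c s) = fun_scale c (tensor_map X' Y' h k s)"
    "tensor_map X' Y' h k 0 = 0" for s t c
    by (auto simp: tensor_map_def fun_eq_iff fun_scale_def)
  have sub: "fun_space.subspace (vecs (tensor_space X' Y'))"
    using is_vspace_tensor_space[of X' Y'] by (simp add: is_vspace_def)
  have "tensor_map X' Y' h k t \<in> vecs (tensor_space X' Y')" if "t \<in> vecs (tensor_space X Y)" for t
    using that
  proof (induction rule: tensor_space_induct)
    case (pure x y)
    thus ?case using assms
      by (auto simp: tensor_map_pure[OF assms] linear_map_def intro!: pure_tensor_in)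
  next
    case zero
    show ?case unfolding hom using sub by (rule fun_space.subspace_0)
  next
    case (add s t)
    thus ?case unfolding hom using sub fun_space.subspace_add by blast
  next
    case (scale c t)
    thus ?case unfolding hom using sub fun_space.subspace_scale by blast
  qed
  thus ?thesis unfolding linear_map_def scl_tensor_space using hom by blast
qed

lemma tensor_assoc_bilinear:
  assumes "is_vspace Y" "is_vspace Z" "bilinear_map X (tensor_space Y Z) base_field B"
  shows "z \<in> vecs Z \<Longrightarrow> bilinear_map X Y base_field (\<lambda>x y. B x (pure_tensor Y Z y z))"
    and "bilinear_map (tensor_space X Y) Z base_field
           (\<lambda>s z. s (\<lambda>x y. B x (pure_tensor Y Z y z)))"
proof -
  note bp = bilinear_pure_tensor[OF assms(1,2)]
  show 1: "bilinear_map X Y base_field (\<lambda>x y. B x (pure_tensor Y Z y z))" if "z \<in> vecs Z" for z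
    using assms(3) bp that by (auto simp: bilinear_map_def linear_map_def)
  have 2: "linear_map Z base_field (\<lambda>z. s (\<lambda>x y. B x (pure_tensor Y Z y z)))"
    if "s \<in> vecs (tensor_space X Y)" for s
    using that
  proof (induction rule: tensor_space_induct)
    case (pure x y)
    have Z: "scl Z c z \<in> vecs Z" "z + z' \<in> vecs Z" if "z \<in> vecs Z" "z' \<in> vecs Z" for c z z'
      using assms(2) that module.subspace_add module.subspace_scale module_iff_vector_space
      by (fastforce simp: is_vspace_def)+
    have "linear_map Z base_field (\<lambda>z. B x (pure_tensor Y Z y z))"
      using assms(3) bp pure by (auto simp: bilinear_map_def linear_map_def)
    thus ?case using 1 Z by (auto simp: linear_map_def pure_tensor_def[of X Y])
  qed (auto simp: linear_map_def fun_scale_def algebra_simps)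
  show "bilinear_map (tensor_space X Y) Z base_field
           (\<lambda>s z. s (\<lambda>x y. B x (pure_tensor Y Z y z)))"
    using 2 by (auto simp: bilinear_map_def) (auto simp: linear_map_def fun_scale_def)
qed

lemma tensor_assoc_pure:
  assumes "is_vspace Y" "is_vspace Z" "x \<in> vecs X" "y \<in> vecs Y" "z \<in> vecs Z"
  shows "tensor_assoc X Y Z (pure_tensor (tensor_space X Y) Z (pure_tensor X Y x y) z)
           = pure_tensor X (tensor_space Y Z) x (pure_tensor Y Z y z)"
  using tensor_assoc_bilinear[OF assms(1,2), of X] assms
  by (auto simp: tensor_assoc_def pure_tensor_def[of "tensor_space X Y"]
      pure_tensor_def[of X "tensor_space Y Z"] pure_tensor_def[of X Y] fun_eq_iff)

lemma tensor_assoc_add: "tensor_assoc X Y Z (s + t) = tensor_assoc X Y Z s + tensor_assoc X Y Z t"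
  and tensor_assoc_scale: "tensor_assoc X Y Z (fun_scale c s) = fun_scale c (tensor_assoc X Y Z s)"
  by (auto simp: tensor_assoc_def fun_eq_iff fun_scale_def)


section \<open>BiHom-algebras\<close>

text \<open>
  The underlying space of an algebra is a whole type.  The multiplication is a linear map on
  the tensor product, so it is meaningful only on \<open>vecs (tensor_space G G)\<close>; \<open>prod_of scale \<mu> g h\<close>
  is the product \<open>gh = \<mu> (g \<otimes> h)\<close>.
\<close>

abbreviation prod_of ::
  "('k::field \<Rightarrow> 'g::ab_group_add \<Rightarrow> 'g) \<Rightarrow> (('k, 'g, 'g) tensor \<Rightarrow> 'g) \<Rightarrow> 'g \<Rightarrow> 'g \<Rightarrow> 'g" where
  "prod_of scale \<mu> g h \<equiv> \<mu> (pure_tensor (whole_space scale) (whole_space scale) g h)"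

locale bihom_algebra = vector_space scale
  for scale :: "'k::field_char_0 \<Rightarrow> 'g::ab_group_add \<Rightarrow> 'g" +
  fixes \<mu> :: "('k, 'g, 'g) tensor \<Rightarrow> 'g"
    and \<alpha> \<beta> :: "'g \<Rightarrow> 'g"
  assumes mu_linear:
      "linear_map (tensor_space (whole_space scale) (whole_space scale)) (whole_space scale) \<mu>"
    and alpha_linear: "Vector_Spaces.linear scale scale \<alpha>"
    and beta_linear: "Vector_Spaces.linear scale scale \<beta>"
    and commute: "\<alpha> \<circ> \<beta> = \<beta> \<circ> \<alpha>"
    and bihom_assoc: "\<And>g h k. prod_of scale \<mu> (\<alpha> g) (prod_of scale \<mu> h k) =
                             prod_of scale \<mu> (prod_of scale \<mu> g h) (\<beta> k)"
    and alpha_mult: "\<And>h k. \<alpha> (prod_of scale \<mu> h k) = prod_of scale \<mu> (\<alpha> h) (\<alpha> k)"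
    and beta_mult: "\<And>h k. \<beta> (prod_of scale \<mu> h k) = prod_of scale \<mu> (\<beta> h) (\<beta> k)"

locale bihom_algebra_morphism =
  source: bihom_algebra scale \<mu> \<alpha> \<beta> + target: bihom_algebra scale' \<mu>' \<alpha>' \<beta>'
  for scale :: "'k::field_char_0 \<Rightarrow> 'g::ab_group_add \<Rightarrow> 'g" and \<mu> \<alpha> \<beta>
    and scale' :: "'k \<Rightarrow> 'h::ab_group_add \<Rightarrow> 'h" and \<mu>' \<alpha>' \<beta>' +
  fixes f :: "'g \<Rightarrow> 'h"
  assumes f_linear: "Vector_Spaces.linear scale scale' f"
    and f_mu: "\<And>t. t \<in> vecs (tensor_space (whole_space scale) (whole_space scale)) \<Longrightarrow>
      \<mu>' (tensor_map (whole_space scale') (whole_space scale') f f t) = f (\<mu> t)"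
    and f_alpha: "f \<circ> \<alpha> = \<alpha>' \<circ> f"
    and f_beta: "f \<circ> \<beta> = \<beta>' \<circ> f"

definition bihom_ideal ::
  "('k::field \<Rightarrow> 'g::ab_group_add \<Rightarrow> 'g) \<Rightarrow> (('k, 'g, 'g) tensor \<Rightarrow> 'g) \<Rightarrow> ('g \<Rightarrow> 'g) \<Rightarrow> ('g \<Rightarrow> 'g)
    \<Rightarrow> 'g set \<Rightarrow> bool" where
  "bihom_ideal scale \<mu> \<alpha> \<beta> H \<longleftrightarrow>
     module.subspace scale H \<and> \<alpha> ` H \<subseteq> H \<and> \<beta> ` H \<subseteq> H \<and>
     (\<forall>a. \<forall>b\<in>H. prod_of scale \<mu> a b \<in> H \<and> prod_of scale \<mu> b a \<in> H)"

text \<open>\<open>G / H\<close> is finite-dimensional: it is spanned by the classes of finitely many vectors.\<close>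

definition finite_codim :: "('k::field \<Rightarrow> 'g::ab_group_add \<Rightarrow> 'g) \<Rightarrow> 'g set \<Rightarrow> bool" where
  "finite_codim scale H \<longleftrightarrow>
     (\<exists>S. finite S \<and> (\<forall>x. \<exists>y \<in> module.span scale S. x - y \<in> H))"


section \<open>BiHom-coalgebras\<close>

record ('k, 'c) coalgebra = "('k, 'c) vspace" +
  comult :: "'c \<Rightarrow> ('k, 'c, 'c) tensor"
  psi :: "'c \<Rightarrow> 'c"
  phi :: "'c \<Rightarrow> 'c"

locale bihom_coalgebra =
  fixes C :: "('k::field_char_0, 'c::ab_group_add) coalgebra"
  assumes vspace: "is_vspace C"
    and comult_linear: "linear_map C (tensor_space C C) (comult C)"
    and psi_linear: "linear_map C C (psi C)"
    and phi_linear: "linear_map C C (phi C)"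
    and commute: "\<And>c. c \<in> vecs C \<Longrightarrow> psi C (phi C c) = phi C (psi C c)"
    and bihom_coassoc: "\<And>c. c \<in> vecs C \<Longrightarrow>
      tensor_map C (tensor_space C C) (phi C) (comult C) (comult C c) =
      tensor_assoc C C C (tensor_map (tensor_space C C) C (comult C) (psi C) (comult C c))"
    and comult_psi: "\<And>c. c \<in> vecs C \<Longrightarrow>
      comult C (psi C c) = tensor_map C C (psi C) (psi C) (comult C c)"
    and comult_phi: "\<And>c. c \<in> vecs C \<Longrightarrow>
      comult C (phi C c) = tensor_map C C (phi C) (phi C) (comult C c)"

locale bihom_coalgebra_morphism =
  source: bihom_coalgebra C + target: bihom_coalgebra D
  for C :: "('k::field_char_0, 'c::ab_group_add) coalgebra"
    and D :: "('k, 'd::ab_group_add) coalgebra" +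
  fixes h :: "'c \<Rightarrow> 'd"
  assumes h_linear: "linear_map C D h"
    and h_comult: "\<And>c. c \<in> vecs C \<Longrightarrow> comult D (h c) = tensor_map D D h h (comult C c)"
    and h_psi: "\<And>c. c \<in> vecs C \<Longrightarrow> psi D (h c) = h (psi C c)"
    and h_phi: "\<And>c. c \<in> vecs C \<Longrightarrow> phi D (h c) = h (phi C c)"


section \<open>The Sweedler dual\<close>

definition sweedler_space ::
  "('k::field \<Rightarrow> 'g::ab_group_add \<Rightarrow> 'g) \<Rightarrow> (('k, 'g, 'g) tensor \<Rightarrow> 'g) \<Rightarrow> ('g \<Rightarrow> 'g) \<Rightarrow> ('g \<Rightarrow> 'g)
    \<Rightarrow> ('k, 'g \<Rightarrow> 'k) vspace" where
  "sweedler_space scale \<mu> \<alpha> \<beta> =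
     \<lparr>scl = fun_scale,
      vecs = {f. Vector_Spaces.linear scale (*) f \<and>
                 (\<exists>J. bihom_ideal scale \<mu> \<alpha> \<beta> J \<and> finite_codim scale J \<and> (\<forall>x\<in>J. f x = 0))}\<rparr>"

text \<open>
  \<open>sweedler_comult \<dots> f\<close> is the element of \<open>G\<degree> \<otimes> G\<degree>\<close> whose image in \<open>(G \<otimes> G)\<^sup>*\<close> is \<open>f \<circ> \<mu>\<close>.
  In \<open>sweedler_dual\<close> the twisting map \<open>\<psi>\<close> comes from \<open>\<beta>\<close>, and \<open>\<phi>\<close> from \<open>\<alpha>\<close>.
\<close>

definition sweedler_comult ::
  "('k::field \<Rightarrow> 'g::ab_group_add \<Rightarrow> 'g) \<Rightarrow> (('k, 'g, 'g) tensor \<Rightarrow> 'g) \<Rightarrow> ('g \<Rightarrow> 'g) \<Rightarrow> ('g \<Rightarrow> 'g)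
    \<Rightarrow> ('g \<Rightarrow> 'k) \<Rightarrow> ('k, 'g \<Rightarrow> 'k, 'g \<Rightarrow> 'k) tensor" where
  "sweedler_comult scale \<mu> \<alpha> \<beta> f =
     (THE t. t \<in> vecs (tensor_space (sweedler_space scale \<mu> \<alpha> \<beta>) (sweedler_space scale \<mu> \<alpha> \<beta>)) \<and>
             (\<forall>s \<in> vecs (tensor_space (whole_space scale) (whole_space scale)).
                tensor_form t s = f (\<mu> s)))"

definition sweedler_dual ::
  "('k::field \<Rightarrow> 'g::ab_group_add \<Rightarrow> 'g) \<Rightarrow> (('k, 'g, 'g) tensor \<Rightarrow> 'g) \<Rightarrow> ('g \<Rightarrow> 'g) \<Rightarrow> ('g \<Rightarrow> 'g)
    \<Rightarrow> ('k, 'g \<Rightarrow> 'k) coalgebra" where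
  "sweedler_dual scale \<mu> \<alpha> \<beta> =
     \<lparr>scl = scl (sweedler_space scale \<mu> \<alpha> \<beta>),
      vecs = vecs (sweedler_space scale \<mu> \<alpha> \<beta>),
      comult = sweedler_comult scale \<mu> \<alpha> \<beta>,
      psi = (\<lambda>f. f \<circ> \<beta>),
      phi = (\<lambda>f. f \<circ> \<alpha>)\<rparr>"

lemma tensor_form_pure:
  assumes P: "is_vspace P" "scl P = fun_scale" "\<And>f. f \<in> vecs P \<Longrightarrow> linear_map X base_field f"
    and Q: "is_vspace Q" "scl Q = fun_scale" "\<And>g. g \<in> vecs Q \<Longrightarrow> linear_map Y base_field g"
    and "f \<in> vecs P" "g \<in> vecs Q" "x \<in> vecs X" "y \<in> vecs Y"
  shows "tensor_form (pure_tensor P Q f g) (pure_tensor X Y x y) = f x * g y"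
proof -
  have bil: "bilinear_map X Y base_field (\<lambda>x y. f x * g y)" if "f \<in> vecs P" "g \<in> vecs Q" for f g
    using P(3)[OF that(1)] Q(3)[OF that(2)]
    by (auto simp: bilinear_map_def linear_map_def algebra_simps)
  have eq: "pure_tensor X Y x y (\<lambda>x y. f x * g y) = f x * g y" if "f \<in> vecs P" "g \<in> vecs Q" for f g
    using bil[OF that] by (simp add: pure_tensor_def)
  have cP: "f + f' \<in> vecs P" "fun_scale c f \<in> vecs P" if "f \<in> vecs P" "f' \<in> vecs P" for f f' c
    using P(1) that
    by (auto simp: is_vspace_def P(2) fun_space.subspace_add fun_space.subspace_scale)
  have cQ: "g + g' \<in> vecs Q" "fun_scale c g \<in> vecs Q" if "g \<in> vecs Q" "g' \<in> vecs Q" for g g' c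
    using Q(1) that
    by (auto simp: is_vspace_def Q(2) fun_space.subspace_add fun_space.subspace_scale)
  have "bilinear_map P Q base_field (\<lambda>f g. pure_tensor X Y x y (\<lambda>x y. f x * g y))"
    unfolding bilinear_map_def linear_map_def P(2) Q(2) base_field_simps
    by (intro conjI ballI allI; (simp only: eq cP cQ UNIV_I)?; simp add: fun_scale_def algebra_simps)
  thus ?thesis using eq assms(7,8) by (simp add: tensor_form_def pure_tensor_def[of P Q])
qed

end

theory Submission
  imports Defs
begin

text \<open>
  A tensor in \<open>X \<otimes> Y\<close> is determined by its values on products of functionals that separate the
  points of \<open>X\<close> and \<open>Y\<close>.  Hence \<open>\<Delta> h\<close> is the only tensor in \<open>G\<degree> \<otimes> G\<degree>\<close> with
  \<open>\<Delta> h (x, y) = h (x y)\<close>, and every identity between maps built from \<open>\<Delta>\<close> can be tested on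
  points: coassociativity becomes \<open>h (\<alpha> x (y z)) = h ((x y) \<beta> z)\<close>, and compatibility of \<open>f\<degree>\<close>
  with \<open>\<Delta>\<close> becomes \<open>h (f x f y) = h (f (x y))\<close>.  That \<open>f\<degree>\<close> maps into \<open>G\<degree>\<close> holds because the
  preimage of a finite-codimensional ideal under \<open>f\<close> is again one.
\<close>

section \<open>Subspaces of finite codimension\<close>

text \<open>The point is that the spanning vectors lie in \<open>U\<close> itself. Induction on
  \<open>S\<close>: either the vectors of \<open>U\<close> reached without \<open>a\<close> are all
  of \<open>U\<close>, or one vector \<open>u\<close> outside them, having a nonzero
  \<open>a\<close>-coordinate, clears that coordinate from every other vector of
  \<open>U\<close>.\<close>

lemma (in vector_space) finite_spanning_modulo:
  assumes "finite S" "subspace J" "subspace U" "\<And>x. x \<in> U \<Longrightarrow> \<exists>y\<in>span S. x - y \<in> J"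
  shows "\<exists>T. finite T \<and> T \<subseteq> U \<and> (\<forall>x\<in>U. \<exists>y\<in>span T. x - y \<in> J)"
  using assms(1,3,4)
proof (induction S arbitrary: U)
  case empty
  thus ?case by (intro exI[of _ "{}"]) auto
next
  case (insert a S)
  define U' where "U' = {x \<in> U. \<exists>y\<in>span S. x - y \<in> J}"
  have sub: "subspace U'"
  proof (rule subspaceI)
    show "0 \<in> U'"
      using subspace_0[OF insert.prems(1)] subspace_0[OF assms(2)] span_zero
      by (auto simp: U'_def intro!: bexI[of _ 0])
  next
    fix x y assume "x \<in> U'" "y \<in> U'"
    then obtain x' y' where *: "x \<in> U" "y \<in> U" "x' \<in> span S" "y' \<in> span S" "x - x' \<in> J" "y - y' \<in> J"
      by (auto simp: U'_def)
    have "(x + y) - (x' + y') = (x - x') + (y - y')" by simp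
    thus "x + y \<in> U'"
      using * subspace_add[OF insert.prems(1)] subspace_add[OF assms(2)] span_add
      unfolding U'_def by (metis (mono_tags, lifting) mem_Collect_eq)
  next
    fix c x assume "x \<in> U'"
    then obtain x' where *: "x \<in> U" "x' \<in> span S" "x - x' \<in> J"
      by (auto simp: U'_def)
    have "scale c x - scale c x' = scale c (x - x')" by (simp add: scale_right_diff_distrib)
    thus "scale c x \<in> U'"
      using * subspace_scale[OF insert.prems(1)] subspace_scale[OF assms(2)] span_scale
      unfolding U'_def by (metis (mono_tags, lifting) mem_Collect_eq)
  qed
  have "\<exists>T. finite T \<and> T \<subseteq> U' \<and> (\<forall>x\<in>U'. \<exists>y\<in>span T. x - y \<in> J)"
    by (rule insert.IH[OF sub]) (simp add: U'_def)
  then obtain T where T: "finite T" "T \<subseteq> U'" "\<forall>x\<in>U'. \<exists>y\<in>span T. x - y \<in> J"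
    by (elim exE conjE)
  have "U' \<subseteq> U" by (auto simp: U'_def)
  show ?case
  proof (cases "U \<subseteq> U'")
    case True
    hence "U' = U" using \<open>U' \<subseteq> U\<close> by simp
    thus ?thesis using T by (intro exI[of _ T]) simp
  next
    case False
    then obtain u where u: "u \<in> U" "u \<notin> U'" by blast
    obtain y k where y: "u - y \<in> J" "y - scale k a \<in> span S"
      using insert.prems(2)[OF u(1)] by (auto simp: span_breakdown_eq)
    have k: "k \<noteq> 0"
    proof
      assume "k = 0"
      hence "y \<in> span S" using y by simp
      thus False using y(1) u unfolding U'_def by blast
    qed
    have "\<exists>z\<in>span (insert u T). v - z \<in> J" if v: "v \<in> U" for v
    proof -
      obtain y' d where y': "v - y' \<in> J" "y' - scale d a \<in> span S"
        using insert.prems(2)[OF v] by (auto simp: span_breakdown_eq)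
      \<comment> \<open>\<open>d\<close> and \<open>k\<close> are the \<open>a\<close>-coordinates
        of the approximations of \<open>v\<close> and \<open>u\<close>. They cancel in
        \<open>w\<close>, which therefore falls into \<open>U'\<close>.\<close>
      define w where "w = v - scale (d / k) u"
      have "w \<in> U" unfolding w_def
        by (intro subspace_diff[OF insert.prems(1)] v subspace_scale[OF insert.prems(1)] u)
      moreover have "(y' - scale d a) - scale (d / k) (y - scale k a) \<in> span S"
        by (intro span_diff span_scale y y')
      moreover have "w - ((y' - scale d a) - scale (d / k) (y - scale k a)) =
          (v - y') - scale (d / k) (u - y)"
        using k by (simp add: w_def scale_right_diff_distrib algebra_simps)
      moreover have "(v - y') - scale (d / k) (u - y) \<in> J"
        by (intro subspace_diff[OF assms(2)] y' subspace_scale[OF assms(2)] y)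
      ultimately have "w \<in> U'" unfolding U'_def by (metis (mono_tags, lifting) mem_Collect_eq)
      then obtain z where z: "z \<in> span T" "w - z \<in> J" using T by blast
      have "v - (z + scale (d / k) u) = w - z" by (simp add: w_def)
      moreover have "z + scale (d / k) u \<in> span (insert u T)"
        using z(1) span_mono[of T "insert u T"]
        by (intro span_add span_scale) (auto intro: span_base)
      ultimately show ?thesis using z(2) by metis
    qed
    moreover have "finite (insert u T)" "insert u T \<subseteq> U" using T(1,2) u \<open>U' \<subseteq> U\<close> by auto
    ultimately show ?thesis by (intro exI[of _ "insert u T"]) simp
  qed
qed

text \<open>\<open>S\<close> reaches any vector up to an error in \<open>H\<close>. That error is
  corrected modulo \<open>K\<close> by vectors \<open>T\<close> chosen inside \<open>H\<close>, so
  what remains is still in \<open>H\<close>.\<close>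

lemma (in vector_space) finite_codim_Int:
  assumes "subspace H" "subspace K" "finite_codim scale H" "finite_codim scale K"
  shows "finite_codim scale (H \<inter> K)"
proof -
  obtain S where S: "finite S" "\<forall>x. \<exists>y\<in>span S. x - y \<in> H"
    using assms(3) by (auto simp: finite_codim_def)
  obtain S' where S': "finite S'" "\<forall>x. \<exists>y\<in>span S'. x - y \<in> K"
    using assms(4) by (auto simp: finite_codim_def)
  obtain T where T: "finite T" "T \<subseteq> H" "\<forall>x\<in>H. \<exists>y\<in>span T. x - y \<in> K"
    using finite_spanning_modulo[OF S'(1) assms(2,1)] S'(2) by blast
  have "\<exists>z\<in>span (S \<union> T). x - z \<in> H \<inter> K" for x
  proof -
    obtain y where y: "y \<in> span S" "x - y \<in> H" using S by blast
    obtain z where z: "z \<in> span T" "(x - y) - z \<in> K" using T y by blast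
    have "z \<in> H" using z T(2) span_minimal[OF _ assms(1)] by blast
    hence "(x - y) - z \<in> H \<inter> K" using z y subspace_diff[OF assms(1)] by blast
    moreover have "y + z \<in> span (S \<union> T)"
      using y z span_mono[of S "S \<union> T"] span_mono[of T "S \<union> T"] by (intro span_add) auto
    ultimately show ?thesis by (metis diff_diff_add)
  qed
  thus ?thesis unfolding finite_codim_def using S T by (intro exI[of _ "S \<union> T"]) auto
qed

text \<open>Spanning vectors modulo \<open>J\<close> are chosen inside \<open>range f\<close>, so
  that they lift along \<open>f\<close>; the lifts span modulo the preimage.\<close>

lemma finite_codim_vimage:
  assumes f: "Vector_Spaces.linear s s' f" and J: "module.subspace s' J" "finite_codim s' J"
  shows "finite_codim s (f -` J)"
proof -
  interpret f: Vector_Spaces.linear s s' f by fact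
  obtain S where S: "finite S" "\<forall>x. \<exists>y\<in>f.vs2.span S. x - y \<in> J"
    using J(2) by (auto simp: finite_codim_def)
  have "f.vs2.subspace (range f)" by (simp add: f.subspace_image f.vs1.subspace_UNIV)
  from f.vs2.finite_spanning_modulo[OF S(1) J(1) this] S(2)
  obtain T where T: "finite T" "T \<subseteq> range f" "\<forall>x. \<exists>y\<in>f.vs2.span T. f x - y \<in> J" by auto
  obtain R where R: "finite R" "T = f ` R" using finite_subset_image[OF T(1,2)] by blast
  have "\<exists>y\<in>f.vs1.span R. x - y \<in> f -` J" for x
    using T(3) by (auto simp: R f.span_image f.diff)
  thus ?thesis using R unfolding finite_codim_def by blast
qed

section \<open>Functionals and coordinates modulo a subspace\<close>

lemma (in vector_space) exists_separating_functional:
  assumes "subspace J" "a \<notin> J"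
  shows "\<exists>\<psi>. Vector_Spaces.linear scale (*) \<psi> \<and> \<psi> a = 1 \<and> (\<forall>x\<in>J. \<psi> x = 0)"
proof -
  interpret K: vector_space "(*) :: 'a \<Rightarrow> 'a \<Rightarrow> 'a"
    by unfold_locales (auto simp: algebra_simps)
  interpret q: vector_space_pair scale "(*) :: 'a \<Rightarrow> 'a \<Rightarrow> 'a"
    by unfold_locales
  obtain B where B: "B \<subseteq> J" "independent B" "J \<subseteq> span B"
    using maximal_independent_subset by blast
  have sB: "span B = J" using B assms(1) by (simp add: span_minimal subset_antisym)
  hence "independent (insert a B)" using B assms by (simp add: independent_insert)
  then obtain \<psi> where \<psi>: "Vector_Spaces.linear scale (*) \<psi>"
      "\<forall>x\<in>insert a B. \<psi> x = (if x = a then 1 else 0)"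
    using q.linear_independent_extend[of "insert a B" "\<lambda>x. if x = a then 1 else 0"] by blast
  interpret psi: Vector_Spaces.linear scale "(*)" \<psi> by fact
  have "\<psi> x = 0" if "x \<in> J" for x
  proof (rule psi.eq_0_on_span)
    show "x \<in> span B" using that sB by simp
    show "\<psi> b = 0" if "b \<in> B" for b using that \<psi>(2) B(1) assms(2) by auto
  qed
  thus ?thesis using \<psi> by (intro exI[of _ \<psi>]) simp
qed

lemma linear_functional_iff:
  assumes "vector_space s"
  shows "Vector_Spaces.linear s (*) f \<longleftrightarrow>
           (\<forall>x y. f (x + y) = f x + f y) \<and> (\<forall>c x. f (s c x) = (c::'k::field) * f x)"
proof -
  interpret vector_space s by fact
  interpret K: vector_space "(*) :: 'k \<Rightarrow> 'k \<Rightarrow> 'k"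
    by unfold_locales (auto simp: algebra_simps)
  show ?thesis
    by (simp add: Vector_Spaces.linear_iff vector_space_axioms K.vector_space_axioms)
qed

text \<open>Finitely many coordinate functionals on the quotient by \<open>J\<close>, with
  representatives \<open>e i\<close>; the comultiplication is built from them. In the induction
  \<open>a\<close> moves from the spanning set into the subspace, and the error left in
  \<open>J' = span (insert a J)\<close> needs at most one more coordinate.\<close>

lemma (in vector_space) dual_family_modulo:
  assumes "finite S" "subspace J" "\<And>x. \<exists>y\<in>span S. x - y \<in> J"
  shows "\<exists>n::nat. \<exists>\<phi> e. (\<forall>i<n. Vector_Spaces.linear scale (*) (\<phi> i) \<and> (\<forall>x\<in>J. \<phi> i x = 0)) \<and>
           (\<forall>x. x - (\<Sum>i<n. scale (\<phi> i x) (e i)) \<in> J)"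
  using assms
proof (induction S arbitrary: J)
  case empty
  thus ?case by (intro exI[of _ 0]) auto
next
  case (insert a S)
  define J' where "J' = span (insert a J)"
  have J': "x \<in> J' \<longleftrightarrow> (\<exists>k. x - scale k a \<in> J)" for x
    using insert.prems(1) by (simp add: J'_def span_breakdown_eq span_eq_iff[THEN iffD2])
  have "\<exists>y\<in>span S. x - y \<in> J'" for x
  proof -
    obtain y k where "x - y \<in> J" "y - scale k a \<in> span S"
      using insert.prems(2)[of x] by (auto simp: span_breakdown_eq)
    moreover have "x - (y - scale k a) - scale k a = x - y" by simp
    ultimately show ?thesis using J' by metis
  qed
  hence "\<exists>n::nat. \<exists>\<phi> e. (\<forall>i<n. Vector_Spaces.linear scale (*) (\<phi> i) \<and> (\<forall>x\<in>J'. \<phi> i x = 0)) \<and>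
      (\<forall>x. x - (\<Sum>i<n. scale (\<phi> i x) (e i)) \<in> J')"
    by (intro insert.IH) (simp_all add: J'_def)
  then obtain n :: nat and \<phi> e where
      *: "\<forall>i<n. Vector_Spaces.linear scale (*) (\<phi> i) \<and> (\<forall>x\<in>J'. \<phi> i x = 0)"
      and e: "\<And>x. x - (\<Sum>i<n. scale (\<phi> i x) (e i)) \<in> J'"
    by (elim exE conjE) blast
  have \<phi>: "\<And>i. i < n \<Longrightarrow> Vector_Spaces.linear scale (*) (\<phi> i)" "\<And>i x. i < n \<Longrightarrow> x \<in> J' \<Longrightarrow> \<phi> i x = 0"
    using * by simp_all
  have "J \<subseteq> J'" by (auto simp: J'_def intro: span_base)
  show ?case
  proof (cases "a \<in> J")
    case True
    hence "J' = J" using insert.prems(1) by (simp add: J'_def insert_absorb span_eq_iff[THEN iffD2])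
    thus ?thesis using * e by (intro exI[of _ n] exI[of _ \<phi>] exI[of _ e]) simp
  next
    case False
    then obtain \<psi> where \<psi>: "Vector_Spaces.linear scale (*) \<psi>" "\<psi> a = 1" "\<And>x. x \<in> J \<Longrightarrow> \<psi> x = 0"
      using exists_separating_functional[OF insert.prems(1)] by blast
    interpret psi: Vector_Spaces.linear scale "(*)" \<psi> by fact
    \<comment> \<open>\<open>p x\<close> is what the expansion modulo \<open>J'\<close> leaves over:
      modulo \<open>J\<close> a multiple of \<open>a\<close>, whose factor is read off by
      \<open>\<psi>\<close>. As \<open>p\<close> fixes \<open>J\<close> pointwise,
      \<open>\<psi> \<circ> p\<close> vanishes there.\<close>
    define p where "p = (\<lambda>x. x - (\<Sum>i<n. scale (\<phi> i x) (e i)))"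
    have p_add: "p (x + y) = p x + p y" for x y
    proof -
      have "(\<Sum>i<n. scale (\<phi> i (x + y)) (e i)) =
          (\<Sum>i<n. scale (\<phi> i x) (e i)) + (\<Sum>i<n. scale (\<phi> i y) (e i))"
        unfolding sum.distrib[symmetric]
        using \<phi>(1) by (intro sum.cong)
          (auto simp: linear_functional_iff[OF vector_space_axioms] scale_left_distrib)
      thus ?thesis by (simp add: p_def)
    qed
    have p_scale: "p (scale c x) = scale c (p x)" for c x
    proof -
      have "(\<Sum>i<n. scale (\<phi> i (scale c x)) (e i)) = scale c (\<Sum>i<n. scale (\<phi> i x) (e i))"
        unfolding scale_sum_right
        using \<phi>(1) by (intro sum.cong)
          (auto simp: linear_functional_iff[OF vector_space_axioms])
      thus ?thesis by (simp add: p_def scale_right_diff_distrib)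
    qed
    have pJ: "p x = x" if "x \<in> J" for x
      using \<phi>(2) \<open>J \<subseteq> J'\<close> that by (simp add: p_def subset_iff)
    define \<phi>' where "\<phi>' = \<phi>(n := \<psi> \<circ> p)"
    have "Vector_Spaces.linear scale (*) (\<phi>' i) \<and> (\<forall>x\<in>J. \<phi>' i x = 0)" if "i < Suc n" for i
      using that \<phi> \<open>J \<subseteq> J'\<close> pJ \<psi>
      by (cases "i = n") (auto simp: \<phi>'_def linear_functional_iff[OF vector_space_axioms]
          p_add p_scale psi.add psi.scale)
    moreover have "x - (\<Sum>i<Suc n. scale (\<phi>' i x) ((e(n := a)) i)) \<in> J" for x
    proof -
      obtain k where k: "p x - scale k a \<in> J" using e[of x] J' by (auto simp: p_def)
      have "\<psi> (p x) = k"
        using \<psi>(3)[OF k] \<psi>(2) by (simp add: psi.diff psi.scale)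
      moreover have "x - (\<Sum>i<Suc n. scale (\<phi>' i x) ((e(n := a)) i)) = p x - scale (\<psi> (p x)) a"
        by (simp add: \<phi>'_def p_def algebra_simps)
      ultimately show ?thesis using k by simp
    qed
    ultimately show ?thesis by blast
  qed
qed


section \<open>Tensors as finite sums\<close>

lemma is_vspaceD:
  assumes "is_vspace X"
  shows "vector_space (scl X)" "0 \<in> vecs X"
    "x \<in> vecs X \<Longrightarrow> y \<in> vecs X \<Longrightarrow> x + y \<in> vecs X"
    "x \<in> vecs X \<Longrightarrow> scl X c x \<in> vecs X"
    "x \<in> vecs X \<Longrightarrow> y \<in> vecs X \<Longrightarrow> x - y \<in> vecs X"
proof -
  show v: "vector_space (scl X)" using assms by (simp add: is_vspace_def)
  interpret vector_space "scl X" by fact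
  have s: "subspace (vecs X)" using assms by (simp add: is_vspace_def)
  show "0 \<in> vecs X" "x \<in> vecs X \<Longrightarrow> y \<in> vecs X \<Longrightarrow> x + y \<in> vecs X"
    "x \<in> vecs X \<Longrightarrow> scl X c x \<in> vecs X" "x \<in> vecs X \<Longrightarrow> y \<in> vecs X \<Longrightarrow> x - y \<in> vecs X"
    using subspace_0[OF s] subspace_add[OF s] subspace_scale[OF s] subspace_diff[OF s] by auto
qed

lemma is_vspace_whole: "vector_space s \<Longrightarrow> is_vspace (whole_space s)"
  by (simp add: is_vspace_def whole_space_def module.subspace_UNIV module_iff_vector_space)

lemma bilinear_mapD:
  assumes "bilinear_map X Y base_field B"
  shows "x \<in> vecs X \<Longrightarrow> x' \<in> vecs X \<Longrightarrow> y \<in> vecs Y \<Longrightarrow> B (x + x') y = B x y + B x' y"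
    "x \<in> vecs X \<Longrightarrow> y \<in> vecs Y \<Longrightarrow> y' \<in> vecs Y \<Longrightarrow> B x (y + y') = B x y + B x y'"
    "x \<in> vecs X \<Longrightarrow> y \<in> vecs Y \<Longrightarrow> B (scl X c x) y = c * B x y"
    "x \<in> vecs X \<Longrightarrow> y \<in> vecs Y \<Longrightarrow> B x (scl Y c y) = c * B x y"
  using assms by (auto simp: bilinear_map_def linear_map_def)

lemma bilinear_mapI:
  assumes "\<And>x x' y. x \<in> vecs X \<Longrightarrow> x' \<in> vecs X \<Longrightarrow> y \<in> vecs Y \<Longrightarrow> B (x + x') y = B x y + B x' y"
    "\<And>x y y'. x \<in> vecs X \<Longrightarrow> y \<in> vecs Y \<Longrightarrow> y' \<in> vecs Y \<Longrightarrow> B x (y + y') = B x y + B x y'"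
    "\<And>c x y. x \<in> vecs X \<Longrightarrow> y \<in> vecs Y \<Longrightarrow> B (scl X c x) y = c * B x y"
    "\<And>c x y. x \<in> vecs X \<Longrightarrow> y \<in> vecs Y \<Longrightarrow> B x (scl Y c y) = c * B x y"
  shows "bilinear_map X Y base_field B"
  using assms by (auto simp: bilinear_map_def linear_map_def)

lemma bilinear_map_mult:
  assumes "linear_map X base_field a" "linear_map Y base_field b"
  shows "bilinear_map X Y base_field (\<lambda>x y. a x * b y)"
  using assms by (intro bilinear_mapI) (auto simp: linear_map_def algebra_simps)

lemma bilinear_map_cong:
  assumes "is_vspace X" "is_vspace Y" "\<And>x y. x \<in> vecs X \<Longrightarrow> y \<in> vecs Y \<Longrightarrow> B x y = B' x y"
    "bilinear_map X Y base_field B"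
  shows "bilinear_map X Y base_field B'"
  by (rule bilinear_mapI)
    (simp_all add: assms(3)[symmetric] is_vspaceD[OF assms(1)] is_vspaceD[OF assms(2)]
      bilinear_mapD[OF assms(4)])

text \<open>The span is replaced by one finite sum of evaluations. The last clause records the value
  0 that pure tensors take off the bilinear forms, which matters for equality of tensors as
  functions.\<close>

lemma tensor_sum:
  assumes "t \<in> vecs (tensor_space X Y)" "is_vspace X"
  obtains n :: nat and u v where "\<And>i. i < n \<Longrightarrow> u i \<in> vecs X" "\<And>i. i < n \<Longrightarrow> v i \<in> vecs Y"
    "\<And>B. bilinear_map X Y base_field B \<Longrightarrow> t B = (\<Sum>i<n. B (u i) (v i))"
    "\<And>B. \<not> bilinear_map X Y base_field B \<Longrightarrow> t B = 0"
proof -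
  have "\<exists>n::nat. \<exists>u v. (\<forall>i<n. u i \<in> vecs X) \<and> (\<forall>i<n. v i \<in> vecs Y) \<and>
      (\<forall>B. bilinear_map X Y base_field B \<longrightarrow> t B = (\<Sum>i<n. B (u i) (v i))) \<and>
      (\<forall>B. \<not> bilinear_map X Y base_field B \<longrightarrow> t B = 0)"
    using assms(1) unfolding tensor_space_def vspace.simps
  proof (induction rule: fun_space.span_induct_alt)
    case base
    show ?case by (intro exI[of _ 0]) auto
  next
    case (step c p t)
    obtain x y where p: "p = pure_tensor X Y x y" "x \<in> vecs X" "y \<in> vecs Y" using step(1) by auto
    obtain n :: nat and u v where *: "\<forall>i<n. u i \<in> vecs X" "\<forall>i<n. v i \<in> vecs Y"
      "\<forall>B. bilinear_map X Y base_field B \<longrightarrow> t B = (\<Sum>i<n. B (u i) (v i))"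
      "\<forall>B. \<not> bilinear_map X Y base_field B \<longrightarrow> t B = 0"
      using step(2) by blast
    show ?case
      using * p is_vspaceD(4)[OF assms(2)]
      by (intro exI[of _ "Suc n"] exI[of _ "u(n := scl X c x)"] exI[of _ "v(n := y)"])
        (auto simp: less_Suc_eq fun_scale_def pure_tensor_def bilinear_mapD)
  qed
  thus ?thesis using that by metis
qed

text \<open>Bilinearity itself depends only on values on the carriers, so \<open>B\<close> and
  \<open>B'\<close> fall on the same side of the case distinction in
  \<open>tensor_sum\<close>.\<close>

lemma tensor_cong:
  assumes "t \<in> vecs (tensor_space X Y)" "is_vspace X" "is_vspace Y"
    and "\<And>x y. x \<in> vecs X \<Longrightarrow> y \<in> vecs Y \<Longrightarrow> B x y = B' x y"
  shows "t B = t B'"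
proof -
  obtain n :: nat and u v where *: "\<And>i. i < n \<Longrightarrow> u i \<in> vecs X" "\<And>i. i < n \<Longrightarrow> v i \<in> vecs Y"
    "\<And>B. bilinear_map X Y base_field B \<Longrightarrow> t B = (\<Sum>i<n. B (u i) (v i))"
    "\<And>B. \<not> bilinear_map X Y base_field B \<Longrightarrow> t B = 0"
    using tensor_sum[OF assms(1,2)] by blast
  have "bilinear_map X Y base_field B \<longleftrightarrow> bilinear_map X Y base_field B'"
    using bilinear_map_cong[OF assms(2,3), of B B'] bilinear_map_cong[OF assms(2,3), of B' B] assms(4)
    by metis
  thus ?thesis
    using * assms(4) by (cases "bilinear_map X Y base_field B") auto
qed

text \<open>By its type a tensor is an arbitrary function of forms; its additivity in the form comes
  from \<open>tensor_sum\<close> and is confined to bilinear forms.\<close>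

lemma tensor_eval_add:
  assumes "t \<in> vecs (tensor_space X Y)" "is_vspace X"
    "bilinear_map X Y base_field B" "bilinear_map X Y base_field B'"
  shows "t (\<lambda>x y. B x y + B' x y) = t B + t B'"
proof -
  have "bilinear_map X Y base_field (\<lambda>x y. B x y + B' x y)"
    using assms(3,4) by (auto simp: bilinear_map_def linear_map_def algebra_simps)
  moreover obtain n :: nat and u v where "\<And>i. i < n \<Longrightarrow> u i \<in> vecs X" "\<And>i. i < n \<Longrightarrow> v i \<in> vecs Y"
    "\<And>B. bilinear_map X Y base_field B \<Longrightarrow> t B = (\<Sum>i<n. B (u i) (v i))"
    "\<And>B. \<not> bilinear_map X Y base_field B \<Longrightarrow> t B = 0"
    using tensor_sum[OF assms(1,2)] by blast
  ultimately show ?thesis using assms(3-) by (simp add: sum.distrib)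
qed

lemma tensor_eval_scale:
  assumes "t \<in> vecs (tensor_space X Y)" "is_vspace X" "bilinear_map X Y base_field B"
  shows "t (\<lambda>x y. c * B x y) = c * t B"
proof -
  have "bilinear_map X Y base_field (\<lambda>x y. c * B x y)"
    using assms(3) by (auto simp: bilinear_map_def linear_map_def algebra_simps)
  moreover obtain n :: nat and u v where "\<And>i. i < n \<Longrightarrow> u i \<in> vecs X" "\<And>i. i < n \<Longrightarrow> v i \<in> vecs Y"
    "\<And>B. bilinear_map X Y base_field B \<Longrightarrow> t B = (\<Sum>i<n. B (u i) (v i))"
    "\<And>B. \<not> bilinear_map X Y base_field B \<Longrightarrow> t B = 0"
    using tensor_sum[OF assms(1,2)] by blast
  ultimately show ?thesis using assms(3-) by (simp add: sum_distrib_left)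
qed

text \<open>The last term is eliminated: if \<open>a i (u n) \<noteq> 0\<close>, then \<open>v n\<close> is a combination of the other
  \<open>v j\<close>.\<close>

lemma separated_sum_eq_0:
  assumes X: "is_vspace X" and Y: "is_vspace Y"
    and a: "\<And>i. linear_map X base_field (a i)" "\<And>x. x \<in> vecs X \<Longrightarrow> (\<And>i. a i x = 0) \<Longrightarrow> x = 0"
    and b: "\<And>j. linear_map Y base_field (b j)" "\<And>y. y \<in> vecs Y \<Longrightarrow> (\<And>j. b j y = 0) \<Longrightarrow> y = 0"
    and B: "bilinear_map X Y base_field B"
    and uv: "\<And>k. k < n \<Longrightarrow> u k \<in> vecs X" "\<And>k. k < n \<Longrightarrow> v k \<in> vecs Y"
    and 0: "\<And>i j. (\<Sum>k<n. a i (u k) * b j (v k)) = 0"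
  shows "(\<Sum>k<(n::nat). B (u k) (v k)) = 0"
  using uv 0
proof (induction n arbitrary: u)
  case 0
  show ?case by simp
next
  case (Suc n)
  interpret X: vector_space "scl X" using is_vspaceD[OF X] by simp
  interpret Y: vector_space "scl Y" using is_vspaceD[OF Y] by simp
  note mem = is_vspaceD(2-)[OF X] is_vspaceD(2-)[OF Y]
  have a_diff: "a i (x - scl X c x') = a i x - c * a i x'" if "x \<in> vecs X" "x' \<in> vecs X" for i c x x'
  proof -
    have "a i ((x - scl X c x') + scl X c x') = a i (x - scl X c x') + a i (scl X c x')"
      using a(1)[of i] that mem unfolding linear_map_def by blast
    moreover have "a i (scl X c x') = c * a i x'"
      using a(1)[of i] that unfolding linear_map_def by simp
    ultimately show ?thesis by simp
  qed
  have B_diff: "B (x - scl X c x') y = B x y - c * B x' y"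
    if "x \<in> vecs X" "x' \<in> vecs X" "y \<in> vecs Y" for c x x' y
  proof -
    have "B ((x - scl X c x') + scl X c x') y = B (x - scl X c x') y + c * B x' y"
      using that mem by (simp only: bilinear_mapD[OF B])
    thus ?thesis by simp
  qed
  have B_zero: "B 0 y = 0" if "y \<in> vecs Y" for y
    using bilinear_mapD(3)[OF B mem(1) that, of 0] by (simp only: X.scale_zero_left) simp
  have B_zero_right: "B x 0 = 0" if "x \<in> vecs X" for x
    using bilinear_mapD(4)[OF B that mem(5), of 0] by (simp only: Y.scale_zero_left) simp
  have b_zero: "b j 0 = 0" for j
    using b(1)[of j] mem(5) unfolding linear_map_def
    by (metis Y.scale_zero_left base_field_simps(1) mult_zero_left)
  show ?case
  proof (cases "u n = 0")
    case True
    have "a i 0 = 0" for i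
      using a(1)[of i] mem(1) unfolding linear_map_def
      by (metis X.scale_zero_left base_field_simps(1) mult_zero_left)
    hence "(\<Sum>k<n. B (u k) (v k)) = 0"
      using Suc.prems True by (intro Suc.IH) auto
    thus ?thesis using True B_zero Suc.prems by simp
  next
    case False
    then obtain i0 where i0: "a i0 (u n) \<noteq> 0" using a(2) Suc.prems(1) by blast
    \<comment> \<open>Normalised so that \<open>c n = 1\<close>; the relation below then expresses
      \<open>v n\<close> through the other \<open>v k\<close>.\<close>
    define c where "c k = a i0 (u k) / a i0 (u n)" for k
    have m: "(\<Sum>k<m. scl Y (c k) (v k)) \<in> vecs Y \<and>
        b j (\<Sum>k<m. scl Y (c k) (v k)) = (\<Sum>k<m. c k * b j (v k)) \<and>
        (\<forall>x\<in>vecs X. B x (\<Sum>k<m. scl Y (c k) (v k)) = (\<Sum>k<m. c k * B x (v k)))" if "m \<le> Suc n" for m j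
      using that
    proof (induction m)
      case 0
      thus ?case using mem b_zero B_zero_right by simp
    next
      case (Suc m)
      have "v m \<in> vecs Y" using Suc.prems \<open>\<And>k. k < Suc n \<Longrightarrow> v k \<in> vecs Y\<close> by simp
      thus ?case using Suc mem b(1)[of j] by (simp add: linear_map_def bilinear_mapD[OF B])
    qed
    \<comment> \<open>Under \<open>b j\<close> this sum becomes the hypothesis for \<open>i0\<close>
      divided by \<open>a i0 (u n)\<close>, and the \<open>b j\<close> separate points.\<close>
    have "(\<Sum>k<Suc n. scl Y (c k) (v k)) = 0"
    proof (rule b(2))
      show "(\<Sum>k<Suc n. scl Y (c k) (v k)) \<in> vecs Y" using m by blast
      fix j
      have "(\<Sum>k<Suc n. c k * b j (v k)) = (\<Sum>k<Suc n. a i0 (u k) * b j (v k)) / a i0 (u n)"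
        unfolding sum_divide_distrib by (simp add: c_def)
      also have "\<dots> = 0" using Suc.prems(3) by simp
      finally show "b j (\<Sum>k<Suc n. scl Y (c k) (v k)) = 0" using m[of "Suc n" j] by simp
    qed
    moreover have "c n = 1" using i0 by (simp add: c_def)
    ultimately have bn: "b j (v n) = - (\<Sum>k<n. c k * b j (v k))"
      and Bn: "x \<in> vecs X \<Longrightarrow> B x (v n) = - (\<Sum>k<n. c k * B x (v k))" for j x
      using m[of "Suc n" j] b_zero B_zero_right
      by (simp_all add: eq_neg_iff_add_eq_0 add.commute)
    \<comment> \<open>Substituting for \<open>v n\<close> turns each \<open>u k\<close> into
      \<open>u k - scl X (c k) (u n)\<close> and keeps \<open>v\<close>; hence the induction over
      arbitrary \<open>u\<close>.\<close>
    have "(\<Sum>k<n. B (u k - scl X (c k) (u n)) (v k)) = 0"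
    proof (rule Suc.IH)
      fix i j
      have "(\<Sum>k<n. a i (u k - scl X (c k) (u n)) * b j (v k)) =
          (\<Sum>k<n. a i (u k) * b j (v k)) - a i (u n) * (\<Sum>k<n. c k * b j (v k))"
        unfolding sum_distrib_left sum_subtractf[symmetric]
        using Suc.prems by (intro sum.cong) (auto simp: a_diff algebra_simps)
      also have "\<dots> = 0" using Suc.prems(3)[of i j] by (simp add: bn)
      finally show "(\<Sum>k<n. a i (u k - scl X (c k) (u n)) * b j (v k)) = 0" .
    qed (use Suc.prems mem in auto)
    also have "(\<Sum>k<n. B (u k - scl X (c k) (u n)) (v k)) =
        (\<Sum>k<n. B (u k) (v k)) - (\<Sum>k<n. c k * B (u n) (v k))"
      unfolding sum_subtractf[symmetric]
      using Suc.prems by (intro sum.cong) (auto simp: B_diff)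
    finally show ?thesis using Bn[of "u n"] Suc.prems by simp
  qed
qed

text \<open>On bilinear forms \<open>s - t\<close> is a sum to which
  \<open>separated_sum_eq_0\<close> applies; elsewhere it is 0. The index types of \<open>a\<close>
  and \<open>b\<close> may differ: coassociativity uses points on one side and pairs of points on
  the other.\<close>

lemma tensor_separated:
  assumes X: "is_vspace X" and Y: "is_vspace Y"
    and a: "\<And>i. linear_map X base_field (a i)" "\<And>x. x \<in> vecs X \<Longrightarrow> (\<And>i. a i x = 0) \<Longrightarrow> x = 0"
    and b: "\<And>j. linear_map Y base_field (b j)" "\<And>y. y \<in> vecs Y \<Longrightarrow> (\<And>j. b j y = 0) \<Longrightarrow> y = 0"
    and s: "s \<in> vecs (tensor_space X Y)" and t: "t \<in> vecs (tensor_space X Y)"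
    and eq: "\<And>i j. s (\<lambda>x y. a i x * b j y) = t (\<lambda>x y. a i x * b j y)"
  shows "s = t"
proof -
  have "s - t \<in> vecs (tensor_space X Y)"
    using is_vspaceD(5)[OF is_vspace_tensor_space] s t by blast
  then obtain n :: nat and u v where *: "\<And>i. i < n \<Longrightarrow> u i \<in> vecs X" "\<And>i. i < n \<Longrightarrow> v i \<in> vecs Y"
    "\<And>B. bilinear_map X Y base_field B \<Longrightarrow> (s - t) B = (\<Sum>i<n. B (u i) (v i))"
    "\<And>B. \<not> bilinear_map X Y base_field B \<Longrightarrow> (s - t) B = 0"
    using tensor_sum[OF _ X] by blast
  have 0: "(\<Sum>k<n. a i (u k) * b j (v k)) = 0" for i j
    using *(3)[OF bilinear_map_mult[OF a(1)[of i] b(1)[of j]]] eq[of i j] by simp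
  have "(\<Sum>i<n. B (u i) (v i)) = 0" if "bilinear_map X Y base_field B" for B
    by (rule separated_sum_eq_0[where a = a and b = b]) (fact X Y a b that *(1,2) 0)+
  hence "(s - t) B = 0" for B
    using *(3,4)[of B]
    by (cases "bilinear_map X Y base_field B") auto
  thus ?thesis by (auto simp: fun_eq_iff)
qed

text \<open>Membership lets both sides of coassociativity be compared by
  \<open>tensor_separated\<close>. The left factor is itself a tensor, so an inner induction
  decomposes it.\<close>

lemma tensor_assoc_in:
  assumes X: "is_vspace X" and Y: "is_vspace Y" and Z: "is_vspace Z"
    and "t \<in> vecs (tensor_space (tensor_space X Y) Z)"
  shows "tensor_assoc X Y Z t \<in> vecs (tensor_space X (tensor_space Y Z))"
  using assms(4)
proof (induction rule: tensor_space_induct)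
  let ?V = "tensor_space X (tensor_space Y Z)"
  note V = is_vspaceD[OF is_vspace_tensor_space[of X "tensor_space Y Z"], simplified]
  have t0: "tensor_assoc X Y Z 0 = 0" by (simp add: tensor_assoc_def fun_eq_iff)
  {
    case (pure s z)
    note bil = bilinear_pure_tensor[OF is_vspace_tensor_space[of X Y] Z]
    from pure(1) show ?case
    proof (induction rule: tensor_space_induct)
      case (pure x y)
      thus ?case using \<open>z \<in> vecs Z\<close>
        by (simp add: tensor_assoc_pure[OF Y Z] pure_tensor_in)
    next
      case zero
      have "pure_tensor (tensor_space X Y) Z 0 z = 0"
        using bilinear_mapD(3)[where c = 0 and X = "tensor_space X Y" and Y = Z]
          is_vspaceD(2)[OF is_vspace_tensor_space[of X Y]] \<open>z \<in> vecs Z\<close>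
        by (fastforce simp: pure_tensor_def fun_eq_iff fun_scale_def zero_fun_def)
      thus ?case using t0 V(2) by metis
    next
      case (add s t)
      hence "pure_tensor (tensor_space X Y) Z (s + t) z =
          pure_tensor (tensor_space X Y) Z s z + pure_tensor (tensor_space X Y) Z t z"
        using bil \<open>z \<in> vecs Z\<close> by (auto simp: bilinear_map_def linear_map_def)
      thus ?case using add V(3) by (simp only: tensor_assoc_add)
    next
      case (scale c t)
      hence "pure_tensor (tensor_space X Y) Z (fun_scale c t) z =
          fun_scale c (pure_tensor (tensor_space X Y) Z t z)"
        using bil \<open>z \<in> vecs Z\<close> by (auto simp: bilinear_map_def linear_map_def)
      thus ?case using scale V(4) by (simp only: tensor_assoc_scale)
    qed
  next
    case zero
    show ?case using V(2) by (simp only: t0)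
  next
    case (add s t)
    thus ?case using V(3) by (simp only: tensor_assoc_add)
  next
    case (scale c t)
    thus ?case using V(4) by (simp only: tensor_assoc_scale)
  }
qed


section \<open>The Sweedler dual of a BiHom-algebra\<close>

context bihom_algebra
begin

abbreviation G :: "('k, 'g) vspace" where "G \<equiv> whole_space scale"

abbreviation m :: "'g \<Rightarrow> 'g \<Rightarrow> 'g" where "m \<equiv> prod_of scale \<mu>"

abbreviation D :: "('k, 'g \<Rightarrow> 'k) coalgebra" where "D \<equiv> sweedler_dual scale \<mu> \<alpha> \<beta>"

lemma whole_space_simps [simp]: "scl G = scale" "vecs G = UNIV"
  by (simp_all add: whole_space_def)

lemma is_vspace_G: "is_vspace G"
  by (simp add: is_vspace_whole vector_space_axioms)

lemma m_linear:
  "m (x + y) z = m x z + m y z" "m z (x + y) = m z x + m z y"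
  "m (scale c x) z = scale c (m x z)" "m z (scale c x) = scale c (m z x)"
  using bilinear_pure_tensor[OF is_vspace_G is_vspace_G] mu_linear
  by (simp_all add: bilinear_map_def linear_map_def pure_tensor_in)

lemma dual_simps [simp]: "scl D = fun_scale" "psi D h = h \<circ> \<beta>" "phi D h = h \<circ> \<alpha>"
  by (simp_all add: sweedler_dual_def sweedler_space_def)

lemma mem_dual_iff:
  "h \<in> vecs D \<longleftrightarrow> (\<forall>x y. h (x + y) = h x + h y) \<and> (\<forall>c x. h (scale c x) = c * h x) \<and>
     (\<exists>J. bihom_ideal scale \<mu> \<alpha> \<beta> J \<and> finite_codim scale J \<and> (\<forall>x\<in>J. h x = 0))"
  by (simp add: sweedler_dual_def sweedler_space_def linear_functional_iff[OF vector_space_axioms])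

lemma bihom_ideal_Int:
  assumes "bihom_ideal scale \<mu> \<alpha> \<beta> H" "bihom_ideal scale \<mu> \<alpha> \<beta> K"
  shows "bihom_ideal scale \<mu> \<alpha> \<beta> (H \<inter> K)"
  using assms by (auto simp: bihom_ideal_def subspace_inter)

text \<open>Addition is the point: if two functionals vanish on ideals \<open>H\<close> and
  \<open>K\<close>, their sum vanishes on \<open>H \<inter> K\<close>, again an ideal of finite
  codimension.\<close>

lemma is_vspace_dual: "is_vspace D"
proof -
  have "bihom_ideal scale \<mu> \<alpha> \<beta> UNIV" "finite_codim scale UNIV"
    by (auto simp: bihom_ideal_def finite_codim_def intro!: exI[of _ "{}"])
  hence "0 \<in> vecs D" by (auto simp: mem_dual_iff)
  moreover have "f + g \<in> vecs D" if f: "f \<in> vecs D" and g: "g \<in> vecs D" for f g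
  proof -
    obtain H where H: "bihom_ideal scale \<mu> \<alpha> \<beta> H" "finite_codim scale H" "\<forall>x\<in>H. f x = 0"
      using f by (auto simp: mem_dual_iff)
    obtain K where K: "bihom_ideal scale \<mu> \<alpha> \<beta> K" "finite_codim scale K" "\<forall>x\<in>K. g x = 0"
      using g by (auto simp: mem_dual_iff)
    have "finite_codim scale (H \<inter> K)"
      using H K by (intro finite_codim_Int) (auto simp: bihom_ideal_def)
    moreover have "\<forall>x\<in>H \<inter> K. (f + g) x = 0" using H K by simp
    ultimately show ?thesis
      using bihom_ideal_Int[OF H(1) K(1)] f g unfolding mem_dual_iff
      by (auto simp: algebra_simps)
  qed
  moreover have "fun_scale c f \<in> vecs D" if f: "f \<in> vecs D" for c f
  proof -
    obtain H where H: "bihom_ideal scale \<mu> \<alpha> \<beta> H" "finite_codim scale H" "\<forall>x\<in>H. f x = 0"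
      using f by (auto simp: mem_dual_iff)
    have "\<forall>x\<in>H. fun_scale c f x = 0" using H by (simp add: fun_scale_def)
    thus ?thesis
      using H(1,2) f unfolding mem_dual_iff by (auto simp: fun_scale_def algebra_simps)
  qed
  ultimately have "fun_space.subspace (vecs D)"
    by (intro fun_space.subspaceI)
  thus ?thesis by (simp add: is_vspace_def fun_space.vector_space_axioms)
qed

lemma dual_linear: "h \<in> vecs D \<Longrightarrow> linear_map G base_field h"
  by (simp add: mem_dual_iff linear_map_def)

section \<open>Tensors over the dual, tested at pairs of points\<close>

lemma eval_linear: "linear_map D base_field (\<lambda>h. h x)"
  by (simp add: linear_map_def fun_scale_def)

lemma eval_separates: "(\<And>x. h x = 0) \<Longrightarrow> h = (0 :: 'g \<Rightarrow> 'k)"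
  by (simp add: fun_eq_iff)

lemma eval_tensor_linear: "linear_map (tensor_space D D) base_field (\<lambda>t. t B)"
  by (simp add: linear_map_def fun_scale_def)

text \<open>Elements of the dual are functions, so evaluations at points separate them and serve on
  both sides of \<open>tensor_separated\<close>.\<close>

lemma dual_tensor_eqI:
  assumes "s \<in> vecs (tensor_space D D)" "t \<in> vecs (tensor_space D D)"
    and "\<And>x y. s (\<lambda>f g. f x * g y) = t (\<lambda>f g. f x * g y)"
  shows "s = t"
  by (rule tensor_separated[where a = "\<lambda>x h. h x" and b = "\<lambda>x h. h x",
        OF is_vspace_dual is_vspace_dual])
    (use assms eval_linear eval_separates in auto)

text \<open>\<open>D\<close> extends the record \<open>sweedler_space\<close> by the coalgebra
  operations. Tensor spaces depend only on scaling and carrier, so the definition of the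
  comultiplication may be read over \<open>D\<close>.\<close>

lemma tensor_space_sweedler:
  "tensor_space (sweedler_space scale \<mu> \<alpha> \<beta>) (sweedler_space scale \<mu> \<alpha> \<beta>) = tensor_space D D"
  by (simp add: tensor_space_def pure_tensor_def bilinear_map_def linear_map_def sweedler_dual_def)

text \<open>Makes \<open>tensor_form t s\<close> linear in \<open>s\<close>, through
  \<open>tensor_eval_add\<close> and \<open>tensor_eval_scale\<close> applied to
  \<open>t\<close>.\<close>

lemma form_bilinear:
  assumes "s \<in> vecs (tensor_space G G)"
  shows "bilinear_map D D base_field (\<lambda>f g. s (\<lambda>x y. f x * g y))"
proof (rule bilinear_mapI)
  note add = tensor_eval_add[OF assms is_vspace_G]
    and scale = tensor_eval_scale[OF assms is_vspace_G]
    and mult = bilinear_map_mult[OF dual_linear dual_linear]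
  fix f f' g g' :: "'g \<Rightarrow> 'k" and c
  assume f: "f \<in> vecs D" and g: "g \<in> vecs D"
  show "s (\<lambda>x y. (f + f') x * g y) = s (\<lambda>x y. f x * g y) + s (\<lambda>x y. f' x * g y)"
    if "f' \<in> vecs D"
    using add[OF mult[OF f g] mult[OF that g]] by (simp add: algebra_simps)
  show "s (\<lambda>x y. f x * (g + g') y) = s (\<lambda>x y. f x * g y) + s (\<lambda>x y. f x * g' y)"
    if "g' \<in> vecs D"
    using add[OF mult[OF f g] mult[OF f that]] by (simp add: algebra_simps)
  show "s (\<lambda>x y. (scl D c f) x * g y) = c * s (\<lambda>x y. f x * g y)"
    using scale[OF mult[OF f g], of c] by (simp add: fun_scale_def algebra_simps)
  show "s (\<lambda>x y. f x * (scl D c g) y) = c * s (\<lambda>x y. f x * g y)"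
    using scale[OF mult[OF f g], of c] by (simp add: fun_scale_def algebra_simps)
qed

text \<open>Off the dual the inner form need not be bilinear, and the pure tensor may give 0 instead
  of \<open>f x * g y\<close>; \<open>tensor_cong\<close> confines the comparison to the
  dual.\<close>

lemma tensor_form_eval:
  assumes "t \<in> vecs (tensor_space D D)"
  shows "tensor_form t (pure_tensor G G x y) = t (\<lambda>f g. f x * g y)"
  unfolding tensor_form_def
proof (rule tensor_cong[OF assms is_vspace_dual is_vspace_dual])
  fix f g assume "f \<in> vecs D" "g \<in> vecs D"
  hence "bilinear_map G G base_field (\<lambda>x y. f x * g y)"
    by (intro bilinear_map_mult dual_linear)
  thus "pure_tensor G G x y (\<lambda>x y. f x * g y) = f x * g y"
    by (simp add: pure_tensor_def)
qed

text \<open>\<open>sweedler_comult\<close> demands agreement on the whole tensor square of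
  \<open>G\<close>, while tests are made at points. Both sides are linear in \<open>s\<close>, so
  pure tensors suffice.\<close>

lemma tensor_form_mu:
  assumes h: "h \<in> vecs D" and t: "t \<in> vecs (tensor_space D D)"
    and eq: "\<And>x y. t (\<lambda>f g. f x * g y) = h (m x y)"
    and s: "s \<in> vecs (tensor_space G G)"
  shows "tensor_form t s = h (\<mu> s)"
  using s
proof (induction rule: tensor_space_induct)
  case (pure x y)
  show ?case using tensor_form_eval[OF t] eq by simp
next
  case zero
  \<comment> \<open>\<open>tensor_form t 0\<close> is \<open>t\<close> at the zero form, which is
    bilinear and equal to 0 times itself.\<close>
  have "bilinear_map D D base_field (\<lambda>_ _. 0)" by (rule bilinear_mapI) auto
  hence "t (\<lambda>_ _. 0) = 0"
    using tensor_eval_scale[OF t is_vspace_dual, of "\<lambda>_ _. 0" 0] by simp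
  moreover have "\<mu> 0 = 0"
    using linear_map_zero[OF is_vspace_tensor_space is_vspace_G mu_linear] .
  moreover have "h 0 = 0"
    by (metis h mem_dual_iff scale_zero_left mult_zero_left)
  ultimately show ?case by (simp only: tensor_form_def) simp
next
  case (add s s')
  have "tensor_form t (s + s') = tensor_form t s + tensor_form t s'"
    using tensor_eval_add[OF t is_vspace_dual form_bilinear[OF add(1)] form_bilinear[OF add(2)]]
    by (simp add: tensor_form_def)
  moreover have "h (\<mu> (s + s')) = h (\<mu> s) + h (\<mu> s')"
    using add(1,2) mu_linear h by (simp add: linear_map_def mem_dual_iff)
  ultimately show ?case using add(3,4) by metis
next
  case (scale c s)
  have "tensor_form t (fun_scale c s) = c * tensor_form t s"
    using tensor_eval_scale[OF t is_vspace_dual form_bilinear[OF scale(1)], of c]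
    by (simp add: tensor_form_def fun_scale_def)
  moreover have "h (\<mu> (fun_scale c s)) = c * h (\<mu> s)"
    using scale(1) mu_linear h by (simp add: linear_map_def mem_dual_iff)
  ultimately show ?case using scale(2) by metis
qed

text \<open>Modulo an ideal \<open>J\<close> of finite codimension killed by \<open>h\<close>, write \<open>x = \<Sum>i. \<phi> i x e\<^sub>i\<close> with
  functionals \<open>\<phi> i\<close> vanishing on \<open>J\<close>; then \<open>h (x y) = \<Sum>i. \<phi> i x * h (e\<^sub>i y)\<close>.\<close>

lemma comult_exists:
  assumes h: "h \<in> vecs D"
  shows "\<exists>t\<in>vecs (tensor_space D D). \<forall>x y. t (\<lambda>f g. f x * g y) = h (m x y)"
proof -
  obtain J where J: "bihom_ideal scale \<mu> \<alpha> \<beta> J" "finite_codim scale J" "\<forall>x\<in>J. h x = 0"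
    using h by (auto simp: mem_dual_iff)
  have sub: "subspace J" using J(1) by (simp add: bihom_ideal_def)
  obtain S where S: "finite S" "\<And>x. \<exists>y\<in>span S. x - y \<in> J"
    using J(2) by (auto simp: finite_codim_def)
  obtain n :: nat and \<phi> e where
      \<phi>: "\<forall>i<n. Vector_Spaces.linear scale (*) (\<phi> i) \<and> (\<forall>x\<in>J. \<phi> i x = 0)"
      and e: "\<forall>x. x - (\<Sum>i<n. scale (\<phi> i x) (e i)) \<in> J"
    using dual_family_modulo[OF S(1) sub S(2)] by (elim exE conjE) blast
  have hl: "h (x + y) = h x + h y" "h (scale c x) = c * h x" for x y c
    using h by (simp_all add: mem_dual_iff)
  have \<phi>D: "\<phi> i \<in> vecs D" if "i < n" for i
    using \<phi> that J(1,2) by (auto simp: mem_dual_iff linear_functional_iff[OF vector_space_axioms])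
  \<comment> \<open>\<open>J\<close> absorbs products with \<open>a\<close>, so this functional
    vanishes on \<open>J\<close> as well.\<close>
  have hD: "(\<lambda>y. h (m a y)) \<in> vecs D" for a
  proof -
    have "\<forall>y\<in>J. h (m a y) = 0" using J(1,3) by (simp add: bihom_ideal_def)
    thus ?thesis using J(1,2) by (auto simp: mem_dual_iff m_linear hl)
  qed
  have "\<exists>t\<in>vecs (tensor_space D D).
      \<forall>x y. t (\<lambda>f g. f x * g y) = (\<Sum>i<k. \<phi> i x * h (m (e i) y))" if "k \<le> n" for k
    using that
  proof (induction k)
    case 0
    show ?case
      using is_vspaceD(2)[OF is_vspace_tensor_space[of D D]] by (intro bexI[of _ 0]) auto
  next
    case (Suc k)
    then obtain t where t: "t \<in> vecs (tensor_space D D)"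
      "\<forall>x y. t (\<lambda>f g. f x * g y) = (\<Sum>i<k. \<phi> i x * h (m (e i) y))" by auto
    let ?p = "pure_tensor D D (\<phi> k) (\<lambda>y. h (m (e k) y))"
    have "?p (\<lambda>f g. f x * g y) = \<phi> k x * h (m (e k) y)" for x y
      using bilinear_map_mult[OF eval_linear eval_linear, of x y] by (simp add: pure_tensor_def)
    moreover have "t + ?p \<in> vecs (tensor_space D D)"
      using Suc.prems
      by (intro is_vspaceD(3)[OF is_vspace_tensor_space] t pure_tensor_in \<phi>D hD) simp
    ultimately show ?case using t(2) by (intro bexI[of _ "t + ?p"]) auto
  qed
  hence "\<exists>t\<in>vecs (tensor_space D D).
      \<forall>x y. t (\<lambda>f g. f x * g y) = (\<Sum>i<n. \<phi> i x * h (m (e i) y))" by blast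
  moreover have "(\<Sum>i<n. \<phi> i x * h (m (e i) y)) = h (m x y)" for x y
  proof -
    have h0: "h 0 = 0" using hl(2)[of 0 0] by simp
    have m0: "m 0 y = 0" using m_linear(3)[of 0 0 y] by simp
    have "h (m (\<Sum>i<k. scale (\<phi> i x) (e i)) y) = (\<Sum>i<k. \<phi> i x * h (m (e i) y))" for k
      by (induction k) (simp_all add: h0 m0 m_linear hl)
    \<comment> \<open>The remainder lies in the ideal \<open>J\<close>, and so does its product with
      \<open>y\<close>.\<close>
    moreover have "h (m (x - (\<Sum>i<n. scale (\<phi> i x) (e i))) y) = 0"
      using e J(1,3) by (simp add: bihom_ideal_def)
    moreover have "h (m x y) = h (m (x - (\<Sum>i<n. scale (\<phi> i x) (e i))) y) +
        h (m (\<Sum>i<n. scale (\<phi> i x) (e i)) y)"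
      unfolding hl(1)[symmetric] m_linear(1)[symmetric] by simp
    ultimately show ?thesis by simp
  qed
  ultimately show ?thesis by auto
qed

text \<open>Identities for the comultiplication go through this rule: \<open>t\<close> meets the
  description in \<open>sweedler_comult\<close> by \<open>tensor_form_mu\<close>, and separation at
  pairs of points leaves no other candidate.\<close>

lemma comult_eqI:
  assumes h: "h \<in> vecs D" and t: "t \<in> vecs (tensor_space D D)"
    and eq: "\<And>x y. t (\<lambda>f g. f x * g y) = h (m x y)"
  shows "comult D h = t"
proof -
  have "sweedler_comult scale \<mu> \<alpha> \<beta> h = t"
    unfolding sweedler_comult_def tensor_space_sweedler
  proof (rule the_equality)
    show "t \<in> vecs (tensor_space D D) \<and> (\<forall>s\<in>vecs (tensor_space G G). tensor_form t s = h (\<mu> s))"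
      using tensor_form_mu[OF h t eq] t by blast
  next
    fix t' assume t': "t' \<in> vecs (tensor_space D D) \<and>
        (\<forall>s\<in>vecs (tensor_space G G). tensor_form t' s = h (\<mu> s))"
    have "t' (\<lambda>f g. f x * g y) = h (m x y)" for x y
      using t' tensor_form_eval[of t' x y] pure_tensor_in[of x G y G] by simp
    thus "t' = t" using t' t eq by (intro dual_tensor_eqI) auto
  qed
  thus ?thesis by (simp add: sweedler_dual_def)
qed

lemma
  assumes h: "h \<in> vecs D"
  shows comult_in: "comult D h \<in> vecs (tensor_space D D)"
    and comult_eval: "comult D h (\<lambda>f g. f x * g y) = h (m x y)"
proof -
  obtain t where t: "t \<in> vecs (tensor_space D D)" "\<And>x y. t (\<lambda>f g. f x * g y) = h (m x y)"
    using comult_exists[OF h] by blast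
  have "comult D h = t" by (rule comult_eqI[OF h t])
  thus "comult D h \<in> vecs (tensor_space D D)" "comult D h (\<lambda>f g. f x * g y) = h (m x y)"
    using t by simp_all
qed

text \<open>An ideal is stable under both twisting maps, so the ideal \<open>J\<close> on which
  \<open>h\<close> vanishes serves for both composites.\<close>

lemma comp_twist_in:
  assumes "h \<in> vecs D"
  shows "h \<circ> \<alpha> \<in> vecs D" "h \<circ> \<beta> \<in> vecs D"
proof -
  obtain J where J: "bihom_ideal scale \<mu> \<alpha> \<beta> J" "finite_codim scale J" "\<forall>x\<in>J. h x = 0"
    using assms by (auto simp: mem_dual_iff)
  interpret a: Vector_Spaces.linear scale scale \<alpha> by (rule alpha_linear)
  interpret b: Vector_Spaces.linear scale scale \<beta> by (rule beta_linear)
  have "\<forall>x\<in>J. (h \<circ> \<alpha>) x = 0" "\<forall>x\<in>J. (h \<circ> \<beta>) x = 0"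
    using J by (auto simp: bihom_ideal_def)
  thus "h \<circ> \<alpha> \<in> vecs D" "h \<circ> \<beta> \<in> vecs D"
    using J(1,2) assms unfolding mem_dual_iff
    by (auto simp: a.add a.scale b.add b.scale)
qed

section \<open>The coalgebra axioms\<close>

lemma comult_linear: "linear_map D (tensor_space D D) (comult D)"
proof -
  note V = is_vspaceD[OF is_vspace_tensor_space[of D D]]
  have "comult D (f + g) = comult D f + comult D g" if "f \<in> vecs D" "g \<in> vecs D" for f g
    using that by (intro comult_eqI V(3) comult_in is_vspaceD(3)[OF is_vspace_dual])
      (simp_all add: comult_eval)
  moreover have "comult D (fun_scale c f) = fun_scale c (comult D f)" if "f \<in> vecs D" for c f
    using that V(4)[of "comult D f" c] is_vspaceD(4)[OF is_vspace_dual, of f c]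
    by (intro comult_eqI) (simp_all add: comult_in, simp add: fun_scale_def comult_eval)
  ultimately show ?thesis by (simp add: linear_map_def comult_in)
qed

lemma phi_linear: "linear_map D D (phi D)"
  and psi_linear: "linear_map D D (psi D)"
  by (simp_all add: linear_map_def comp_twist_in fun_scale_def fun_eq_iff)

lemma tensor_map_eval:
  "tensor_map D D h k t (\<lambda>f g. f x * g y) = t (\<lambda>f g. h f x * k g y)"
  using bilinear_map_mult[OF eval_linear eval_linear, of x y] by (simp add: tensor_map_def)

text \<open>Stated for a multiplicative \<open>p\<close> to serve \<open>\<alpha>\<close> and
  \<open>\<beta>\<close> alike; at \<open>(x, y)\<close> both sides give
  \<open>h (p (m x y))\<close>.\<close>

lemma comult_comp:
  assumes h: "h \<in> vecs D" and l: "linear_map D D (\<lambda>f. f \<circ> p)" and p: "\<And>x y. p (m x y) = m (p x) (p y)"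
  shows "comult D (h \<circ> p) = tensor_map D D (\<lambda>f. f \<circ> p) (\<lambda>f. f \<circ> p) (comult D h)"
proof (rule comult_eqI)
  show "h \<circ> p \<in> vecs D" using h l by (simp add: linear_map_def)
  show "tensor_map D D (\<lambda>f. f \<circ> p) (\<lambda>f. f \<circ> p) (comult D h) \<in> vecs (tensor_space D D)"
    using tensor_map_linear[OF l l] comult_in[OF h] by (simp add: linear_map_def)
  show "tensor_map D D (\<lambda>f. f \<circ> p) (\<lambda>f. f \<circ> p) (comult D h) (\<lambda>f g. f x * g y) = (h \<circ> p) (m x y)"
    for x y
    using comult_eval[OF h, of "p x" "p y"] by (simp add: tensor_map_eval p)
qed

lemma coassoc:
  assumes c: "c \<in> vecs D"
  shows "tensor_map D (tensor_space D D) (phi D) (comult D) (comult D c) =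
    tensor_assoc D D D (tensor_map (tensor_space D D) D (comult D) (psi D) (comult D c))"
\<comment> \<open>The test uses a point \<open>x\<close> on the left factor and a pair
  \<open>p\<close> on the right one, which is itself a tensor space.\<close>
proof (rule tensor_separated[where a = "\<lambda>x h. h x" and b = "\<lambda>p s. s (\<lambda>g h. g (fst p) * h (snd p))",
      OF is_vspace_dual is_vspace_tensor_space])
  show "linear_map D base_field (\<lambda>h. h x)" for x by (rule eval_linear)
  show "linear_map (tensor_space D D) base_field (\<lambda>s. s (\<lambda>g h. g (fst p) * h (snd p)))"
    for p :: "'g \<times> 'g" by (rule eval_tensor_linear)
  show "h = 0" if "\<And>x. h x = 0" for h :: "'g \<Rightarrow> 'k" using that by (rule eval_separates)
  show "s = 0" if "s \<in> vecs (tensor_space D D)" "\<And>p. s (\<lambda>g h. g (fst p) * h (snd p)) = 0" for s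
    using that(2)[of "(_, _)"] is_vspaceD(2)[OF is_vspace_tensor_space[of D D]]
    by (intro dual_tensor_eqI that(1)) simp_all
  show "tensor_map D (tensor_space D D) (phi D) (comult D) (comult D c)
      \<in> vecs (tensor_space D (tensor_space D D))"
    using tensor_map_linear[OF phi_linear comult_linear] comult_in[OF c]
    by (simp add: linear_map_def)
  have T: "tensor_map (tensor_space D D) D (comult D) (psi D) (comult D c)
      \<in> vecs (tensor_space (tensor_space D D) D)"
    using tensor_map_linear[OF comult_linear psi_linear] comult_in[OF c]
    by (simp add: linear_map_def)
  thus "tensor_assoc D D D (tensor_map (tensor_space D D) D (comult D) (psi D) (comult D c))
      \<in> vecs (tensor_space D (tensor_space D D))"
    by (intro tensor_assoc_in is_vspace_dual)
  fix x :: 'g and p :: "'g \<times> 'g"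
  obtain y z where p: "p = (y, z)" by force
  \<comment> \<open>\<open>B\<close> is the test form for \<open>x\<close> and
    \<open>(y, z)\<close>. Its bilinearity keeps \<open>tensor_map\<close> and
    \<open>tensor_assoc\<close> off their default value 0.\<close>
  define B where "B = (\<lambda>(f :: 'g \<Rightarrow> 'k) (s :: ('k, 'g \<Rightarrow> 'k, 'g \<Rightarrow> 'k) tensor).
    f x * s (\<lambda>g h. g y * h z))"
  have B: "bilinear_map D (tensor_space D D) base_field B"
    unfolding B_def by (intro bilinear_map_mult eval_linear eval_tensor_linear)
  have "tensor_map D (tensor_space D D) (phi D) (comult D) (comult D c) B =
      comult D c (\<lambda>f g. f (\<alpha> x) * comult D g (\<lambda>g h. g y * h z))"
    using B by (simp add: tensor_map_def) (simp add: B_def)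
  also have "\<dots> = comult D c (\<lambda>f g. f (\<alpha> x) * g (m y z))"
    by (rule tensor_cong[OF comult_in[OF c] is_vspace_dual is_vspace_dual])
      (simp add: comult_eval)
  also have "\<dots> = c (m (\<alpha> x) (m y z))" by (rule comult_eval[OF c])
  \<comment> \<open>BiHom-associativity enters here; the steps before unfold the left side, those
    after fold up the right side.\<close>
  also have "\<dots> = c (m (m x y) (\<beta> z))" by (simp add: bihom_assoc)
  also have "\<dots> = comult D c (\<lambda>f g. f (m x y) * g (\<beta> z))" by (rule comult_eval[OF c, symmetric])
  also have "\<dots> = comult D c (\<lambda>f g. comult D f (\<lambda>f g. f x * g y) * psi D g z)"
    by (rule tensor_cong[OF comult_in[OF c] is_vspace_dual is_vspace_dual])
      (simp add: comult_eval)
  also have "\<dots> = tensor_map (tensor_space D D) D (comult D) (psi D) (comult D c)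
      (\<lambda>s h. s (\<lambda>f g. f x * g y) * h z)"
    using bilinear_map_mult[OF eval_tensor_linear eval_linear, of "\<lambda>f g. f x * g y" z]
    by (simp add: tensor_map_def)
  also have "\<dots> = tensor_map (tensor_space D D) D (comult D) (psi D) (comult D c)
      (\<lambda>s h. s (\<lambda>f g. B f (pure_tensor D D g h)))"
  \<comment> \<open>\<open>tensor_assoc\<close> puts pure tensors into the right slot of
    \<open>B\<close>; on these \<open>B\<close> splits into \<open>h z\<close> times the test form
    at \<open>(x, y)\<close>.\<close>
  proof (rule tensor_cong[OF T is_vspace_tensor_space is_vspace_dual])
    fix s h assume s: "s \<in> vecs (tensor_space D D)" and h: "h \<in> vecs D"
    have "B f (pure_tensor D D g h) = h z * (f x * g y)" for f g
      using bilinear_map_mult[OF eval_linear eval_linear, of y z]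
      by (simp add: B_def pure_tensor_def)
    hence "s (\<lambda>f g. B f (pure_tensor D D g h)) = s (\<lambda>f g. h z * (f x * g y))" by simp
    also have "\<dots> = h z * s (\<lambda>f g. f x * g y)"
      by (intro tensor_eval_scale[OF s is_vspace_dual] bilinear_map_mult eval_linear)
    finally show "s (\<lambda>f g. f x * g y) * h z = s (\<lambda>f g. B f (pure_tensor D D g h))" by simp
  qed
  also have "\<dots> = tensor_assoc D D D
      (tensor_map (tensor_space D D) D (comult D) (psi D) (comult D c)) B"
    using B by (simp add: tensor_assoc_def)
  finally show "tensor_map D (tensor_space D D) (phi D) (comult D) (comult D c)
        (\<lambda>u v. u x * v (\<lambda>g h. g (fst p) * h (snd p))) =
      tensor_assoc D D D (tensor_map (tensor_space D D) D (comult D) (psi D) (comult D c))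
        (\<lambda>u v. u x * v (\<lambda>g h. g (fst p) * h (snd p)))"
    by (simp add: B_def p)
qed

text \<open>Supplies the coalgebra structure that \<open>bihom_coalgebra_morphism\<close> requires
  at both ends.\<close>

theorem bihom_coalgebra_dual: "bihom_coalgebra D"
proof
  show "psi D (phi D c) = phi D (psi D c)" for c
    using commute by (simp add: o_assoc[symmetric])
  show "comult D (psi D c) = tensor_map D D (psi D) (psi D) (comult D c)" if "c \<in> vecs D" for c
    using comult_comp[OF that, of \<beta>] psi_linear beta_mult by (simp add: sweedler_dual_def)
  show "comult D (phi D c) = tensor_map D D (phi D) (phi D) (comult D c)" if "c \<in> vecs D" for c
    using comult_comp[OF that, of \<alpha>] phi_linear alpha_mult by (simp add: sweedler_dual_def)
qed (fact is_vspace_dual comult_linear psi_linear phi_linear coassoc)+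

end

section \<open>The dual of a morphism\<close>

context bihom_algebra_morphism
begin

lemma f_prod: "f (source.m x y) = target.m (f x) (f y)"
proof -
  have l: "linear_map source.G target.G f"
    using f_linear by (simp add: linear_map_def Vector_Spaces.linear_iff)
  show ?thesis
    using f_mu[of "pure_tensor source.G source.G x y"] pure_tensor_in[of x source.G y source.G]
    by (simp add: tensor_map_pure[OF l l])
qed

lemma bihom_ideal_vimage:
  assumes "bihom_ideal scale' \<mu>' \<alpha>' \<beta>' J"
  shows "bihom_ideal scale \<mu> \<alpha> \<beta> (f -` J)"
proof -
  interpret f: Vector_Spaces.linear scale scale' f by (rule f_linear)
  have "f (\<alpha> x) = \<alpha>' (f x)" "f (\<beta> x) = \<beta>' (f x)" for x
    using f_alpha f_beta by (simp_all add: fun_eq_iff)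
  thus ?thesis
    using assms f.subspace_vimage[of J] by (auto simp: bihom_ideal_def f_prod)
qed

lemma comp_in_dual:
  assumes "h \<in> vecs target.D"
  shows "h \<circ> f \<in> vecs source.D"
proof -
  interpret f: Vector_Spaces.linear scale scale' f by (rule f_linear)
  obtain J where J: "bihom_ideal scale' \<mu>' \<alpha>' \<beta>' J" "finite_codim scale' J" "\<forall>x\<in>J. h x = 0"
    using assms by (auto simp: target.mem_dual_iff)
  have "finite_codim scale (f -` J)"
    using J by (intro finite_codim_vimage[OF f_linear]) (auto simp: bihom_ideal_def)
  moreover have "\<forall>x\<in>f -` J. (h \<circ> f) x = 0" using J(3) by simp
  ultimately show ?thesis
    using bihom_ideal_vimage[OF J(1)] assms unfolding target.mem_dual_iff source.mem_dual_iff
    by (auto simp: f.add f.scale)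
qed

lemma dual_morphism: "bihom_coalgebra_morphism target.D source.D (\<lambda>h. h \<circ> f)"
proof -
  \<comment> \<open>These interpretations discharge the coalgebra assumptions of the morphism locale
    and leave the conditions on the map.\<close>
  interpret C: bihom_coalgebra target.D by (rule target.bihom_coalgebra_dual)
  interpret D: bihom_coalgebra source.D by (rule source.bihom_coalgebra_dual)
  have l: "linear_map target.D source.D (\<lambda>h. h \<circ> f)"
    by (simp add: linear_map_def comp_in_dual fun_scale_def fun_eq_iff)
  show ?thesis
  proof
    show "linear_map target.D source.D (\<lambda>h. h \<circ> f)" by fact
    fix c assume c: "c \<in> vecs target.D"
    show "comult source.D (c \<circ> f) =
        tensor_map source.D source.D (\<lambda>h. h \<circ> f) (\<lambda>h. h \<circ> f) (comult target.D c)"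
    \<comment> \<open>\<open>tensor_map\<close> moves the test points \<open>x\<close> and
      \<open>y\<close> to \<open>f x\<close> and \<open>f y\<close>, where \<open>f_prod\<close>
      turns the product into the image of the product of \<open>x\<close> and
      \<open>y\<close>.\<close>
    proof (rule source.comult_eqI[OF comp_in_dual[OF c]])
      show "tensor_map source.D source.D (\<lambda>h. h \<circ> f) (\<lambda>h. h \<circ> f) (comult target.D c)
          \<in> vecs (tensor_space source.D source.D)"
        using tensor_map_linear[OF l l] target.comult_in[OF c] by (simp add: linear_map_def)
      show "tensor_map source.D source.D (\<lambda>h. h \<circ> f) (\<lambda>h. h \<circ> f) (comult target.D c)
          (\<lambda>u v. u x * v y) = (c \<circ> f) (source.m x y)" for x y
        using target.comult_eval[OF c, of "f x" "f y"]
        by (simp add: source.tensor_map_eval f_prod)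
    qed
    show "psi source.D (c \<circ> f) = psi target.D c \<circ> f"
      using f_beta by (simp add: o_assoc[symmetric])
    show "phi source.D (c \<circ> f) = phi target.D c \<circ> f"
      using f_alpha by (simp add: o_assoc[symmetric])
  qed
qed

end

theorem corollary2p11:
  fixes scale :: "'k::field_char_0 \<Rightarrow> 'g::ab_group_add \<Rightarrow> 'g"
    and scale' :: "'k \<Rightarrow> 'h::ab_group_add \<Rightarrow> 'h"
    and f :: "'g \<Rightarrow> 'h"
  assumes "bihom_algebra scale \<mu> \<alpha> \<beta>"
    and "bihom_algebra scale' \<mu>' \<alpha>' \<beta>'"
    and "bihom_algebra_morphism scale \<mu> \<alpha> \<beta> scale' \<mu>' \<alpha>' \<beta>' f"
  shows "bihom_coalgebra_morphism
           (sweedler_dual scale' \<mu>' \<alpha>' \<beta>') (sweedler_dual scale \<mu> \<alpha> \<beta>) (\<lambda>h. h \<circ> f)"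
  using assms(3) by (rule bihom_algebra_morphism.dual_morphism)

end
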